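(* Let $n\geq 1$ be an integer and let $\tilde\phi_n:=n\phi_n$. There exists a unique probability measure $P_{\tilde\phi_n}$ on $\mathcal S'(\mathbb R)$ such that $$\tilde\phi_n\left(-\frac{\|s\|^2}{2}\right)=\int_{\mathcal S'(\mathbb R)}e^{i\langle w,s\rangle}\,dP_{\tilde\phi_n}(w),\qquad \text{for all } s\in\mathcal S(\mathbb R).$$
   Context: For $n=1,2,\dots$, $\phi_n(z)=\sum_{k=0}^\infty\frac{z^k}{k+n}$ for $|z|<1$, and $\phi_n$ also denotes the analytic continuation of this function to $\mathbb C\setminus[1,\infty)$. $\mathcal S(\mathbb R)$ is the space of real-valued Schwartz test functions on $\mathbb R$, $\|s\|$ is the $L^2(\mathbb R)$ norm of $s$, $\mathcal S'(\mathbb R)$ is its topological dual (real tempered distributions) with the cylinder $\sigma$-algebra, and $\langle w,s\rangle$ is the duality pairing. *)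

theory Defs
  imports "HOL-Complex_Analysis.Complex_Analysis" "HOL-Probability.Probability"
begin

subsection \<open>The functions \<open>\<phi>\<^sub>n\<close>\<close>

definition slit_plane :: "complex set" where
  "slit_plane = - (complex_of_real ` {1..})"

text \<open>
  \<open>phi_extends n f\<close>: \<open>f\<close> is the analytic continuation of the power series to
  \<open>slit_plane\<close>. The value 0 outside \<open>slit_plane\<close> is a convention that makes
  \<open>f\<close> unique as a total function.
\<close>

definition phi_extends :: "nat \<Rightarrow> (complex \<Rightarrow> complex) \<Rightarrow> bool" where
  "phi_extends n f \<longleftrightarrow>
     f holomorphic_on slit_plane \<and>
     (\<forall>z. norm z < 1 \<longrightarrow> f z = (\<Sum>k. z ^ k / of_nat (k + n))) \<and>
     (\<forall>z. z \<notin> slit_plane \<longrightarrow> f z = 0)"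

definition phi :: "nat \<Rightarrow> complex \<Rightarrow> complex" where
  "phi n = (THE f. phi_extends n f)"

definition phi_tilde :: "nat \<Rightarrow> complex \<Rightarrow> complex" where
  "phi_tilde n z = of_nat n * phi n z"

lemma open_slit_plane: "open slit_plane"
proof -
  have "closed (complex_of_real ` {1..})"
    by (intro closed_injective_linear_image) (auto simp: inj_def bounded_linear.linear bounded_linear_of_real)
  then show ?thesis by (simp add: slit_plane_def open_Compl)
qed

lemma slit_plane_iff: "z \<in> slit_plane \<longleftrightarrow> (Im z = 0 \<longrightarrow> Re z < 1)"
  by (auto simp: slit_plane_def image_iff complex_eq_iff not_le)

lemma connected_slit_plane: "connected slit_plane"
proof -
  have "starlike slit_plane"
    unfolding starlike_def
  proof (intro bexI ballI subsetI)
    fix z w :: complex assume z: "z \<in> slit_plane" and "w \<in> closed_segment 0 z"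
    then obtain u where u: "0 \<le> u" "u \<le> 1" "w = u *\<^sub>R z"
      by (auto simp: in_segment)
    have "u * Re z < 1" if "Re z < 1"
    proof (cases "Re z \<le> 0")
      case True
      then show ?thesis using u(1) mult_nonneg_nonpos[of u "Re z"] by simp
    next
      case False
      then show ?thesis using mult_left_le_one_le[of "Re z" u] u that by linarith
    qed
    then show "w \<in> slit_plane" using z u by (auto simp: slit_plane_iff)
  qed (simp add: slit_plane_iff)
  then show ?thesis by (rule starlike_imp_connected)
qed

lemma ball_subset_slit_plane: "ball 0 1 \<subseteq> slit_plane"
proof
  fix z :: complex assume "z \<in> ball 0 1"
  then have "Re z < 1" using complex_Re_le_cmod[of z] by simp
  then show "z \<in> slit_plane" by (simp add: slit_plane_iff)
qed

lemma phi_extends_unique: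
  assumes "phi_extends n f" "phi_extends n g"
  shows "f = g"
proof
  fix z
  show "f z = g z"
  proof (cases "z \<in> slit_plane")
    case True
    have hol: "f holomorphic_on slit_plane" "g holomorphic_on slit_plane"
      using assms by (auto simp: phi_extends_def)
    have eq: "f w = g w" if "w \<in> ball 0 1" for w
      using assms that by (simp add: phi_extends_def)
    show ?thesis
      using analytic_continuation_open[OF open_ball open_slit_plane _ connected_slit_plane
          ball_subset_slit_plane hol eq True] by simp
  next
    case False
    then show ?thesis using assms by (simp add: phi_extends_def)
  qed
qed

lemma phi_series_sums:
  fixes z :: complex
  assumes "norm z < 1"
  shows "(\<lambda>k. z ^ k / of_nat (k + n)) sums (\<Sum>k. z ^ k / of_nat (k + n))"
proof -
  have "summable (\<lambda>k. z ^ k / of_nat (k + n))"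
  proof (rule summable_comparison_test)
    have "norm (z ^ k / of_nat (k + n)) \<le> norm z ^ k" for k
    proof (cases "k + n = 0")
      case False
      then have "1 \<le> real (k + n)" by linarith
      then show ?thesis
        using mult_left_mono[of 1 "real (k + n)" "norm z ^ k"]
        by (simp only: norm_divide norm_power norm_of_nat) (simp add: divide_le_eq)
    qed simp
    then show "\<exists>N. \<forall>k\<ge>N. norm (z ^ k / of_nat (k + n)) \<le> norm z ^ k" by blast
  qed (use assms in simp)
  then show ?thesis by (rule summable_sums)
qed

lemma phi_series_holomorphic:
  "(\<lambda>z::complex. \<Sum>k. z ^ k / of_nat (k + n)) holomorphic_on ball 0 1"
proof (rule power_series_holomorphic[where a = "\<lambda>k. 1 / of_nat (k + n)"])
  fix w :: complex assume "w \<in> ball 0 1"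
  then show "(\<lambda>k. 1 / of_nat (k + n) * (w - 0) ^ k) sums (\<Sum>k. w ^ k / of_nat (k + n))"
    using phi_series_sums[of w n] by simp
qed

lemma phi_extends_step:
  fixes F :: "complex \<Rightarrow> complex"
  assumes hol: "F holomorphic_on slit_plane"
    and eq: "\<And>z. norm z < 1 \<Longrightarrow> F z = c + z * (\<Sum>k. z ^ k / of_nat (k + n))"
  shows "\<exists>f. phi_extends n f"
proof -
  define f where "f z = (if z \<in> ball 0 1 then (\<Sum>k. z ^ k / of_nat (k + n))
                         else if z \<in> slit_plane then (F z - c) / z else 0)" for z
  have "f holomorphic_on ball 0 1"
    using phi_series_holomorphic by (rule holomorphic_transform) (simp add: f_def)
  moreover have "f holomorphic_on (slit_plane - {0})"
  proof (rule holomorphic_transform)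
    show "(\<lambda>z. (F z - c) / z) holomorphic_on (slit_plane - {0})"
      by (intro holomorphic_intros holomorphic_on_subset[OF hol]) auto
  next
    fix z assume "z \<in> slit_plane - {0}"
    then show "(F z - c) / z = f z" by (auto simp: f_def eq)
  qed
  ultimately have "f holomorphic_on (ball 0 1 \<union> (slit_plane - {0}))"
    by (intro holomorphic_on_Un) (auto intro: open_slit_plane)
  moreover have "ball 0 1 \<union> (slit_plane - {0}) = slit_plane"
    using ball_subset_slit_plane by auto
  ultimately have "phi_extends n f"
    using ball_subset_slit_plane by (auto simp: phi_extends_def f_def)
  then show ?thesis by blast
qed

lemma phi_extends_exists:
  assumes "n \<ge> 1"
  shows "\<exists>f. phi_extends n f"
  using assms
proof (induction n rule: dec_induct)
  case base
  show ?case
  proof (rule phi_extends_step[where F = "\<lambda>z. - Ln (1 - z)" and c = 0])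
    show "(\<lambda>z. - Ln (1 - z)) holomorphic_on slit_plane"
      by (intro holomorphic_intros) (auto simp: slit_plane_iff complex_nonpos_Reals_iff)
  next
    fix z :: complex assume z: "norm z < 1"
    have "(\<lambda>k. z ^ k / of_nat k) sums (- Ln (1 - z))"
      using sums_minus[OF Ln_series'[of "- z"]] z by simp
    then have "(\<lambda>k. z ^ Suc k / of_nat (Suc k)) sums (- Ln (1 - z))"
      by (subst sums_Suc_iff) simp
    moreover have "(\<lambda>k. z ^ Suc k / of_nat (Suc k)) sums (z * (\<Sum>k. z ^ k / of_nat (k + 1)))"
      using sums_mult[OF phi_series_sums[OF z, of 1], of z] by simp
    ultimately show "- Ln (1 - z) = 0 + z * (\<Sum>k. z ^ k / of_nat (k + 1))"
      by (simp add: sums_unique2)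
  qed
next
  case (step n)
  then obtain f where f: "phi_extends n f" by blast
  show ?case
  proof (rule phi_extends_step[where F = f and c = "1 / of_nat n"])
    show "f holomorphic_on slit_plane" using f by (simp add: phi_extends_def)
  next
    fix z :: complex assume z: "norm z < 1"
    have "(\<lambda>k. z ^ Suc k / of_nat (Suc k + n)) sums (z * (\<Sum>k. z ^ k / of_nat (k + Suc n)))"
      using sums_mult[OF phi_series_sums[OF z, of "Suc n"], of z] by simp
    then have "(\<lambda>k. z ^ k / of_nat (k + n)) sums
        (z * (\<Sum>k. z ^ k / of_nat (k + Suc n)) + 1 / of_nat n)"
      by (subst (asm) sums_Suc_iff) simp
    then show "f z = 1 / of_nat n + z * (\<Sum>k. z ^ k / of_nat (k + Suc n))"
      using f z phi_series_sums[OF z, of n] by (auto simp: phi_extends_def dest: sums_unique2)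
  qed
qed

lemma phi_extends_phi:
  assumes "n \<ge> 1"
  shows "phi_extends n (phi n)"
  unfolding phi_def
  using phi_extends_exists[OF assms] phi_extends_unique by (metis theI)


subsection \<open>Schwartz functions and tempered distributions\<close>

definition schwartz :: "(real \<Rightarrow> real) set" where
  "schwartz =
     {f. (\<forall>m x. (deriv ^^ m) f field_differentiable at x) \<and>
         (\<forall>k m. bounded (range (\<lambda>x. x ^ k * (deriv ^^ m) f x)))}"

definition schwartz_seminorm :: "nat \<Rightarrow> nat \<Rightarrow> (real \<Rightarrow> real) \<Rightarrow> real" where
  "schwartz_seminorm k m f = (SUP x. \<bar>x ^ k * (deriv ^^ m) f x\<bar>)"

text \<open>
  The locally convex topology of the family of seminorms: the seminorm balls form a subbase.
\<close>

definition schwartz_topology :: "(real \<Rightarrow> real) topology" where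
  "schwartz_topology = topology_generated_by
     {{g \<in> schwartz. schwartz_seminorm k m (\<lambda>x. g x - f x) < e} | f k m e.
        f \<in> schwartz \<and> e > 0}"

definition L2_norm_real :: "(real \<Rightarrow> real) \<Rightarrow> real" where
  "L2_norm_real s = sqrt (LINT x|lborel. (s x)\<^sup>2)"

text \<open>
  The pairing of \<open>w\<close> with \<open>s\<close> is the application \<open>w s\<close>. Functionals are taken in
  \<open>extensional schwartz\<close>, so that two of them are equal if and only if they
  agree on all Schwartz functions.
\<close>

definition tempered :: "((real \<Rightarrow> real) \<Rightarrow> real) set" where
  "tempered =
     {w \<in> extensional schwartz.
        (\<forall>f\<in>schwartz. \<forall>g\<in>schwartz. w (\<lambda>x. f x + g x) = w f + w g) \<and>
        (\<forall>c. \<forall>f\<in>schwartz. w (\<lambda>x. c * f x) = c * w f) \<and>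
        continuous_map schwartz_topology euclideanreal w}"

definition cylinder_sets :: "((real \<Rightarrow> real) \<Rightarrow> real) set set" where
  "cylinder_sets =
     {{w \<in> tempered. restrict w J \<in> B} | J B.
        finite J \<and> J \<subseteq> schwartz \<and> B \<in> sets (Pi\<^sub>M J (\<lambda>_. borel))}"

text \<open>Only the space and the \<open>\<sigma>\<close>-algebra of this measure matter.\<close>

definition tempered_space :: "((real \<Rightarrow> real) \<Rightarrow> real) measure" where
  "tempered_space = sigma tempered cylinder_sets"

lemma space_tempered_space [simp]: "space tempered_space = tempered"
  and sets_tempered_space: "sets tempered_space = sigma_sets tempered cylinder_sets"
  by (auto simp: tempered_space_def cylinder_sets_def intro!: space_measure_of sets_measure_of)

lemma topspace_schwartz_topology: "topspace schwartz_topology = schwartz"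
proof
  show "topspace schwartz_topology \<subseteq> schwartz"
    by (auto simp: schwartz_topology_def topology_generated_by_topspace)
  show "schwartz \<subseteq> topspace schwartz_topology"
  proof
    fix f assume f: "f \<in> schwartz"
    have "f \<in> {g \<in> schwartz. schwartz_seminorm 0 0 (\<lambda>x. g x - f x) < 1}"
      using f by (simp add: schwartz_seminorm_def)
    then show "f \<in> topspace schwartz_topology"
      unfolding schwartz_topology_def topology_generated_by_topspace using f
      by (intro UnionI[of "{g \<in> schwartz. schwartz_seminorm 0 0 (\<lambda>x. g x - f x) < 1}"])
         (auto intro!: exI[of _ f] exI[of _ "0::nat"] exI[of _ "1::real"])
  qed
qed

end

theory Submission
  imports Defs
begin

text \<open>
  For \<open>x \<ge> 0\<close>, \<open>n \<phi>\<^sub>n(-x) = \<integral>\<^sub>0\<^sup>1 n t\<^sup>n\<^sup>-\<^sup>1 / (1 + t x) dt\<close> is the Laplace transform at \<open>x\<close> of \<open>T U\<close>,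
  where \<open>T\<close> has density \<open>n t\<^sup>n\<^sup>-\<^sup>1\<close> on \<open>[0, 1]\<close> and \<open>U\<close> is an independent standard exponential variable. So
  the required measure is the law of \<open>sqrt (T U) W\<close>, with \<open>W\<close> an independent white noise. White noise is
  obtained without the Bochner-Minlos theorem, as the series \<open>\<Sum>\<xi>\<^sub>q \<langle>s, \<psi>\<^sub>q\<rangle>\<close> over the Haar basis of
  \<open>L\<^sup>2(\<real>)\<close> with independent standard Gaussian \<open>\<xi>\<^sub>q\<close>: the Haar coefficients of a Schwartz function are
  bounded by a Schwartz seminorm times a fixed summable sequence \<open>\<beta>\<close>, and \<open>\<Sum>\<bar>\<xi>\<^sub>q\<bar> \<beta>\<^sub>q\<close> is almost surely finite
  because its expectation is. Uniqueness reduces to Levy's one-dimensional theorem, one evaluation at a time.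
\<close>

subsection \<open>The functions \<open>\<phi>\<^sub>n\<close> on the negative half-line\<close>

text \<open>The obstacle is that white noise must be linear and continuous for every outcome. The
  L^2 isometry by itself fixes the random variable attached to each test function only up to a null
  set, and there are uncountably many test functions. Because the sequence bounding the coefficients
  does not depend on the test function, absolute convergence of one random series serves all of
  them, with one exceptional set. The discontinuous Haar functions suffice because one derivative is
  enough. A wavelet of generation k has height 2^(k/2), support of length 2^(-k) and mean zero, so
  its coefficient against a Lipschitz function is of order 2^(-3k/2). The 2^k wavelets of a unit
  interval then contribute 2^(-k/2), a geometric series, and decay like 1/(1 + x^2) makes the sum
  over all unit intervals converge.\<close>

lemma phi_recurrence:
  assumes n: "n \<ge> 1" and z: "z \<in> slit_plane"
  shows "z * phi (Suc n) z = phi n z - 1 / of_nat n"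
\<comment> \<open>The series represents \<open>phi\<close> only on the unit disc, but the identity
  is needed at \<open>- x\<close> for arbitrarily large \<open>x\<close>. Shifting the index proves
  it on the disc, and the identity theorem carries it to the slit plane.\<close>
proof (rule analytic_continuation_open[OF open_ball[of 0 1] open_slit_plane _ connected_slit_plane
        ball_subset_slit_plane _ _ _ z])
  note ext = phi_extends_phi[OF n] phi_extends_phi[of "Suc n"]
  show "(\<lambda>z. z * phi (Suc n) z) holomorphic_on slit_plane"
    "(\<lambda>z. phi n z - 1 / of_nat n) holomorphic_on slit_plane"
    using ext by (auto simp: phi_extends_def intro!: holomorphic_intros)
  fix z :: complex assume "z \<in> ball 0 1"
  then have z: "norm z < 1" by simp
  have "(\<lambda>k. z ^ Suc k / of_nat (Suc k + n)) sums (z * (\<Sum>k. z ^ k / of_nat (k + Suc n)))"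
    using sums_mult[OF phi_series_sums[OF z, of "Suc n"], of z] by simp
  then have "(\<lambda>k. z ^ k / of_nat (k + n)) sums
      (z * (\<Sum>k. z ^ k / of_nat (k + Suc n)) + 1 / of_nat n)"
    by (subst (asm) sums_Suc_iff) simp
  then show "z * phi (Suc n) z = phi n z - 1 / of_nat n"
    using ext z phi_series_sums[OF z, of n] by (auto simp: phi_extends_def dest: sums_unique2)
qed auto

text \<open>On the disc this is the logarithm series; the factor \<open>z\<close> keeps the
  removable singularity at 0 out of the identity. It starts the induction on \<open>n\<close> in
  \<open>has_integral_phi\<close>.\<close>

lemma phi_1_eq_Ln:
  assumes z: "z \<in> slit_plane"
  shows "z * phi 1 z = - Ln (1 - z)"
proof (rule analytic_continuation_open[OF open_ball[of 0 1] open_slit_plane _ connected_slit_plane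
        ball_subset_slit_plane _ _ _ z])
  note ext = phi_extends_phi[of 1, simplified]
  show "(\<lambda>z. z * phi 1 z) holomorphic_on slit_plane"
    using ext by (auto simp: phi_extends_def intro!: holomorphic_intros)
  show "(\<lambda>z. - Ln (1 - z)) holomorphic_on slit_plane"
    by (intro holomorphic_intros) (auto simp: slit_plane_iff complex_nonpos_Reals_iff)
  fix z :: complex assume "z \<in> ball 0 1"
  then have z: "norm z < 1" by simp
  have "(\<lambda>k. z ^ k / of_nat k) sums (- Ln (1 - z))"
    using sums_minus[OF Ln_series'[of "- z"]] z by simp
  then have "(\<lambda>k. z ^ Suc k / of_nat (Suc k)) sums (- Ln (1 - z))"
    by (subst sums_Suc_iff) simp
  moreover have "(\<lambda>k. z ^ Suc k / of_nat (Suc k)) sums (z * (\<Sum>k. z ^ k / of_nat (k + 1)))"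
    using sums_mult[OF phi_series_sums[OF z, of 1], of z] by simp
  ultimately show "z * phi 1 z = - Ln (1 - z)"
    using ext z by (auto simp: phi_extends_def dest: sums_unique2)
qed auto

lemma phi_0:
  assumes "n \<ge> 1"
  shows "phi n 0 = 1 / of_nat n"
  using phi_recurrence[OF assms, of 0] by (simp add: slit_plane_iff)

lemma has_integral_power_unit_interval:
  "((\<lambda>t. t ^ m) has_integral 1 / real (Suc m)) {0..1::real}"
proof -
  have "((\<lambda>t. t ^ m) has_integral (1 ^ Suc m / Suc m - 0 ^ Suc m / Suc m)) {0..1::real}"
  proof (rule fundamental_theorem_of_calculus)
    fix t :: real assume "t \<in> {0..1}"
    have "((\<lambda>t. t ^ Suc m / Suc m) has_real_derivative (Suc m * t ^ m) / Suc m) (at t within {0..1})"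
      using DERIV_pow[of "Suc m" t "{0..1}"] by (intro DERIV_cdivide) (simp del: power_Suc of_nat_Suc)
    then show "((\<lambda>t. t ^ Suc m / Suc m) has_vector_derivative t ^ m) (at t within {0..1})"
      by (simp add: has_real_derivative_iff_has_vector_derivative[symmetric] del: power_Suc of_nat_Suc)
  qed simp
  then show ?thesis by simp
qed

text \<open>Since t^(n-1) - t^(n-1)/(1 + t x) = x t^n/(1 + t x), the integrals obey the recurrence
  of \<open>phi_recurrence\<close>, which gives an induction on \<open>n\<close>. Solving the
  recurrence divides by \<open>x\<close>, hence the separate case 0. The real witness
  \<open>I\<close> also records that the value of \<open>phi\<close> is real.\<close>

lemma has_integral_phi:
  assumes n: "n \<ge> 1" and x: "x \<ge> 0"
  shows "\<exists>I. ((\<lambda>t. t ^ (n - 1) / (1 + t * x)) has_integral I) {0..1} \<and> phi n (of_real (- x)) = of_real I"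
proof (cases "x = 0")
  case True
  have "((\<lambda>t. t ^ (n - 1)) has_integral 1 / real n) {0..1::real}"
    using has_integral_power_unit_interval[of "n - 1"] n by simp
  then show ?thesis using True n phi_0[OF n] by (auto intro!: exI[of _ "1 / real n"])
next
  case False
  with x have x: "x > 0" by simp
  have slit: "of_real (- x) \<in> slit_plane" using x by (simp add: slit_plane_iff)
  from n show ?thesis
  proof (induction n rule: dec_induct)
    case base
    have "((\<lambda>t. 1 / (1 + t * x)) has_integral (ln (1 + 1 * x) / x - ln (1 + 0 * x) / x)) {0..1::real}"
    proof (rule fundamental_theorem_of_calculus)
      fix t :: real assume "t \<in> {0..1}"
      then have "1 + t * x > 0" using x by (simp add: add_pos_nonneg)
      then show "((\<lambda>t. ln (1 + t * x) / x) has_vector_derivative 1 / (1 + t * x)) (at t within {0..1})"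
        unfolding has_real_derivative_iff_has_vector_derivative[symmetric]
        using x by (auto intro!: derivative_eq_intros)
    qed simp
    moreover have "phi 1 (of_real (- x)) = of_real (ln (1 + x) / x)"
    proof -
      have "1 + complex_of_real x = of_real (1 + x)" by simp
      then have "Ln (1 + complex_of_real x) = of_real (ln (1 + x))"
        using x by (simp only: Ln_of_real)
      then show ?thesis using phi_1_eq_Ln[OF slit] x by (simp add: field_simps)
    qed
    ultimately show ?case by auto
  next
    case (step n)
    then obtain I where I: "((\<lambda>t. t ^ (n - 1) / (1 + t * x)) has_integral I) {0..1}"
      and phi: "phi n (of_real (- x)) = of_real I" by blast
    have "((\<lambda>t. t ^ (n - 1)) has_integral 1 / real n) {0..1::real}"
      using has_integral_power_unit_interval[of "n - 1"] step.hyps by simp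
    from has_integral_mult_right[OF has_integral_diff[OF this I], of "1 / x"]
    have "((\<lambda>t. 1 / x * (t ^ (n - 1) - t ^ (n - 1) / (1 + t * x))) has_integral (1 / x * (1 / n - I))) {0..1}" .
    moreover have "1 / x * (t ^ (n - 1) - t ^ (n - 1) / (1 + t * x)) = t ^ n / (1 + t * x)" if "t \<in> {0..1}" for t
    proof -
      have "1 + t * x > 0" using x that by (simp add: add_pos_nonneg)
      moreover have "t ^ n = t * t ^ (n - 1)" using step.hyps by (cases n) auto
      ultimately show ?thesis using x by (simp add: field_simps)
    qed
    ultimately have "((\<lambda>t. t ^ n / (1 + t * x)) has_integral (1 / x * (1 / n - I))) {0..1}"
      by (subst has_integral_cong[symmetric]) auto
    moreover have "phi (Suc n) (of_real (- x)) = of_real (1 / x * (1 / n - I))"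
      using phi_recurrence[OF _ slit, of n] step.hyps(1) phi x by (simp add: field_simps)
    ultimately show ?case by auto
  qed
qed

section \<open>The law of the random scale\<close>

lemma power_density_prob_space:
  assumes "n \<ge> 1"
  shows "prob_space (density lborel (\<lambda>t. ennreal (indicator {0..1} t * (real n * t ^ (n - 1)))))"
    (is "prob_space ?M")
proof
  have "((\<lambda>t. t ^ (n - 1)) has_integral 1 / real n) {0..1::real}"
    using has_integral_power_unit_interval[of "n - 1"] assms by simp
  from has_integral_mult_right[OF this, of "real n"]
  have "((\<lambda>t. n * t ^ (n - 1)) has_integral 1) {0..1::real}" using assms by simp
  then have *: "(\<integral>\<^sup>+ t. ennreal (indicator {0..1} t * (real n * t ^ (n - 1))) \<partial>lborel) = 1"
    using nn_integral_has_integral_lebesgue[of "{0..1}" "\<lambda>t. real n * t ^ (n - 1)" 1] by simp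
  show "emeasure ?M (space ?M) = 1"
    using * by (subst emeasure_density) auto
qed

text \<open>For fixed t, the Laplace transform of t U at \<open>x\<close> is 1/(1 + t x), which
  turns the integral for \<open>phi\<close> into an expectation. The measure is the law of the
  standard deviation sqrt (T U) rather than of the variance, since it will multiply the noise; hence
  \<open>r\<^sup>2\<close> in the exponent.\<close>

lemma phi_tilde_mixture:
  assumes n: "n \<ge> 1"
  shows "\<exists>\<mu>. prob_space \<mu> \<and> sets \<mu> = sets borel \<and>
    (\<forall>x\<ge>0. phi_tilde n (of_real (- x)) = of_real (LINT r|\<mu>. exp (- (r\<^sup>2 * x))))"
proof -
  define T where "T = density lborel (\<lambda>t. ennreal (indicator {0..1} t * (real n * t ^ (n - 1))))"
  define U where "U = density lborel (\<lambda>u. ennreal (exponential_density 1 u))"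
  interpret T: prob_space T unfolding T_def by (rule power_density_prob_space[OF n])
  interpret U: prob_space U unfolding U_def by (rule prob_space_exponential_density) simp
  interpret TU: pair_prob_space T U ..
  have [measurable_cong]: "sets T = sets borel" "sets U = sets borel" by (auto simp: T_def U_def)
  have sp: "space T = UNIV" "space U = UNIV" by (auto simp: T_def U_def)
  \<comment> \<open>Both laws live on nonnegative numbers; \<open>max 0\<close> settles the values
    elsewhere.\<close>
  define f where "f = (\<lambda>(t, u). sqrt (max 0 (t * u)))"
  have f[measurable]: "f \<in> borel_measurable (T \<Otimes>\<^sub>M U)" unfolding f_def by measurable
  define \<mu> where "\<mu> = distr (T \<Otimes>\<^sub>M U) borel f"
  have "prob_space \<mu>" unfolding \<mu>_def by (rule TU.prob_space_distr) simp
  moreover have "sets \<mu> = sets borel" by (simp add: \<mu>_def)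
  moreover have "phi_tilde n (of_real (- x)) = of_real (LINT r|\<mu>. exp (- (r\<^sup>2 * x)))" if x: "x \<ge> 0" for x
  proof -
    obtain I where I: "((\<lambda>t. t ^ (n - 1) / (1 + t * x)) has_integral I) {0..1}"
      and phi: "phi n (of_real (- x)) = of_real I" using has_integral_phi[OF n x] by blast
    have inner: "(LINT u|U. exp (- ((f (t, u))\<^sup>2 * x))) = 1 / (1 + t * x)" if t: "0 \<le> t" for t
    proof -
      have tx: "1 + t * x > 0" using t x by (simp add: add_pos_nonneg)
      \<comment> \<open>Tilting the standard exponential density by exp (- t u x) gives the
        exponential density of rate 1 + t x up to the factor 1/(1 + t x); its total mass 1 evaluates
        the integral.\<close>
      interpret E: prob_space "density lborel (\<lambda>u. ennreal (exponential_density (1 + t * x) u))"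
        by (rule prob_space_exponential_density[OF tx])
      have "(LINT u|U. exp (- ((f (t, u))\<^sup>2 * x))) = (LINT u|lborel. exponential_density 1 u * exp (- ((f (t, u))\<^sup>2 * x)))"
        unfolding U_def
        by (subst integral_density) (auto simp: f_def exponential_density_nonneg)
      also have "\<dots> = (LINT u|lborel. 1 / (1 + t * x) * exponential_density (1 + t * x) u)"
      proof (intro Bochner_Integration.integral_cong)
        fix u :: real
        have "exp (- u) * exp (- (t * u * x)) = exp (- u * (1 + t * x))"
          by (simp add: exp_add[symmetric] algebra_simps)
        then show "exponential_density 1 u * exp (- ((f (t, u))\<^sup>2 * x)) =
            1 / (1 + t * x) * exponential_density (1 + t * x) u"
          using t tx by (simp add: exponential_density_def f_def)
      qed simp
      also have "\<dots> = 1 / (1 + t * x) * (LINT u|density lborel (\<lambda>u. ennreal (exponential_density (1 + t * x) u)). 1)"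
        using tx by (subst integral_density) (auto simp: exponential_density_nonneg)
      also have "\<dots> = 1 / (1 + t * x)" using E.prob_space by simp
      finally show ?thesis .
    qed
    have bnd: "norm (exp (- ((f p)\<^sup>2 * x))) \<le> 1" for p using x by simp
    have "(LINT r|\<mu>. exp (- (r\<^sup>2 * x))) = (LINT p|(T \<Otimes>\<^sub>M U). exp (- ((f p)\<^sup>2 * x)))"
      unfolding \<mu>_def by (subst integral_distr) auto
    also have "\<dots> = (LINT t|T. LINT u|U. exp (- ((f (t, u))\<^sup>2 * x)))"
      by (rule TU.integral_fst'[symmetric], rule TU.integrable_const_bound[where B = 1])
         (use bnd in auto)
    also have "\<dots> = (LINT t|lborel. (indicator {0..1} t * (real n * t ^ (n - 1))) * (LINT u|U. exp (- ((f (t, u))\<^sup>2 * x))))"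
      unfolding T_def by (subst integral_density) (auto simp: T_def[symmetric] split: split_indicator)
    also have "\<dots> = (LINT t|lborel. real n * (indicator {0..1} t * (t ^ (n - 1) / (1 + t * x))))"
      by (intro Bochner_Integration.integral_cong) (auto simp: inner split: split_indicator)
    also have "\<dots> = n * I"
    proof -
      have "set_integrable lborel {0..1} (\<lambda>t. t ^ (n - 1) / (1 + t * x))"
      proof (rule borel_integrable_compact[OF _ continuous_on_divide, unfolded real_scaleR_def, folded set_integrable_def])
        show "\<forall>t\<in>{0..1}. 1 + t * x \<noteq> 0" using x by (metis add_pos_nonneg atLeastAtMost_iff mult_nonneg_nonneg order_less_irrefl zero_less_one)
      qed (auto intro!: continuous_intros)
      then have "(LINT t:{0..1}|lborel. t ^ (n - 1) / (1 + t * x)) = I"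
        using set_borel_integral_eq_integral(2) integral_unique[OF I] by metis
      then show ?thesis
        unfolding set_lebesgue_integral_def real_scaleR_def by (simp only: integral_mult_right_zero)
    qed
    finally show ?thesis using phi by (simp add: phi_tilde_def)
  qed
  ultimately show ?thesis by blast
qed

subsection \<open>Schwartz functions\<close>

lemma schwartz_differentiable:
  assumes "f \<in> schwartz"
  shows "(deriv ^^ m) f field_differentiable at x"
  using assms by (simp add: schwartz_def)

lemma higher_deriv_schwartz_add:
  assumes "f \<in> schwartz" "g \<in> schwartz"
  shows "(deriv ^^ m) (\<lambda>x. f x + g x) = (\<lambda>x. (deriv ^^ m) f x + (deriv ^^ m) g x)"
proof (induction m)
  case (Suc m)
  show ?case using assms by (simp add: Suc schwartz_differentiable fun_eq_iff)
qed simp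

lemma higher_deriv_schwartz_cmult:
  assumes "f \<in> schwartz"
  shows "(deriv ^^ m) (\<lambda>x. c * f x) = (\<lambda>x. c * (deriv ^^ m) f x)"
proof (induction m)
  case (Suc m)
  show ?case using assms by (simp add: Suc schwartz_differentiable fun_eq_iff)
qed simp

lemma schwartz_add:
  assumes "f \<in> schwartz" "g \<in> schwartz"
  shows "(\<lambda>x. f x + g x) \<in> schwartz"
proof -
  have "bounded (range (\<lambda>x. x ^ k * ((deriv ^^ m) f x + (deriv ^^ m) g x)))" for k m
    unfolding distrib_left using assms by (intro bounded_plus_comp) (auto simp: schwartz_def)
  moreover have "(deriv ^^ m) (\<lambda>x. f x + g x) field_differentiable at x" for m x
    unfolding higher_deriv_schwartz_add[OF assms]
    by (intro field_differentiable_add schwartz_differentiable assms)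
  ultimately show ?thesis by (simp add: schwartz_def higher_deriv_schwartz_add[OF assms])
qed

lemma schwartz_cmult:
  assumes "f \<in> schwartz"
  shows "(\<lambda>x. c * f x) \<in> schwartz"
proof -
  have "bounded (range (\<lambda>x. x ^ k * (c * (deriv ^^ m) f x)))" for k m
    using bounded_scaleR_comp[of "\<lambda>x. x ^ k * (deriv ^^ m) f x" UNIV c] assms
    by (simp add: schwartz_def algebra_simps)
  moreover have "(deriv ^^ m) (\<lambda>x. c * f x) field_differentiable at x" for m x
    unfolding higher_deriv_schwartz_cmult[OF assms]
    by (intro field_differentiable_mult field_differentiable_const schwartz_differentiable assms)
  ultimately show ?thesis by (simp add: schwartz_def higher_deriv_schwartz_cmult[OF assms])
qed

lemma schwartz_zero: "(\<lambda>x. 0) \<in> schwartz"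
proof -
  have "(deriv ^^ m) (\<lambda>x::real. 0::real) = (\<lambda>x. 0)" for m by (induction m) auto
  then show ?thesis by (simp add: schwartz_def)
qed

lemma schwartz_diff:
  assumes "f \<in> schwartz" "g \<in> schwartz"
  shows "(\<lambda>x. f x - g x) \<in> schwartz"
  using schwartz_add[OF assms(1) schwartz_cmult[OF assms(2), of "-1"]] by simp

section \<open>Seminorm bounds and continuous functionals\<close>

lemma schwartz_seminorm_ge:
  assumes "f \<in> schwartz"
  shows "\<bar>x ^ k * (deriv ^^ m) f x\<bar> \<le> schwartz_seminorm k m f"
proof -
  have "bounded (range (\<lambda>x. x ^ k * (deriv ^^ m) f x))" using assms by (simp add: schwartz_def)
  then obtain B where "\<And>x. \<bar>x ^ k * (deriv ^^ m) f x\<bar> \<le> B" by (auto simp: bounded_iff)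
  then show ?thesis unfolding schwartz_seminorm_def
    by (intro cSUP_upper) (auto intro!: bdd_aboveI2)
qed

lemma schwartz_seminorm_nonneg:
  assumes "f \<in> schwartz"
  shows "0 \<le> schwartz_seminorm k m f"
  using schwartz_seminorm_ge[OF assms, of 0 k m] by linarith

text \<open>Haar coefficients need the size of \<open>f\<close> (order 0) and its slope (order 1),
  each with the weights 1 and x^2 so that the bounds can be summed over unit intervals.\<close>

definition schwartz_bound :: "(real \<Rightarrow> real) \<Rightarrow> real" where
  "schwartz_bound f = schwartz_seminorm 0 0 f + schwartz_seminorm 2 0 f +
     schwartz_seminorm 0 1 f + schwartz_seminorm 2 1 f"

lemma schwartz_bound_nonneg: "f \<in> schwartz \<Longrightarrow> 0 \<le> schwartz_bound f"
  by (simp add: schwartz_bound_def schwartz_seminorm_nonneg)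

lemma schwartz_decay:
  assumes "f \<in> schwartz"
  shows "\<bar>f x\<bar> \<le> schwartz_bound f / (1 + x\<^sup>2)" "\<bar>deriv f x\<bar> \<le> schwartz_bound f / (1 + x\<^sup>2)"
proof -
  note le = schwartz_seminorm_ge[OF assms, of x 0 0] schwartz_seminorm_ge[OF assms, of x 2 0]
    schwartz_seminorm_ge[OF assms, of x 0 1] schwartz_seminorm_ge[OF assms, of x 2 1]
  have "1 + x\<^sup>2 > 0" by (simp add: add_pos_nonneg)
  then show "\<bar>f x\<bar> \<le> schwartz_bound f / (1 + x\<^sup>2)" "\<bar>deriv f x\<bar> \<le> schwartz_bound f / (1 + x\<^sup>2)"
    using le schwartz_seminorm_nonneg[OF assms, of 0 0] schwartz_seminorm_nonneg[OF assms, of 2 0]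
      schwartz_seminorm_nonneg[OF assms, of 0 1] schwartz_seminorm_nonneg[OF assms, of 2 1]
    by (simp_all add: schwartz_bound_def pos_le_divide_eq abs_mult algebra_simps)
qed

lemma schwartz_has_derivative:
  assumes "f \<in> schwartz"
  shows "(f has_real_derivative deriv f x) (at x)"
  using schwartz_differentiable[OF assms, of 0] by (simp add: field_differentiable_derivI)

lemma schwartz_continuous_on: "f \<in> schwartz \<Longrightarrow> continuous_on A f"
  by (meson DERIV_continuous_on has_field_derivative_at_within schwartz_has_derivative)

lemma openin_schwartz_bound_ball:
  assumes "f \<in> schwartz" "e > 0"
  shows "\<exists>V. openin schwartz_topology V \<and> f \<in> V \<and> V \<subseteq> {g \<in> schwartz. schwartz_bound (\<lambda>x. g x - f x) < e}"
proof -
  define N where "N k m = {g \<in> schwartz. schwartz_seminorm k m (\<lambda>x. g x - f x) < e / 4}" for k m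
  have "openin schwartz_topology (N k m)" for k m
    unfolding schwartz_topology_def N_def using assms
    by (intro topology_generated_by_Basis CollectI exI[of _ f] exI[of _ k] exI[of _ m] exI[of _ "e / 4"]) auto
  then have "openin schwartz_topology (N 0 0 \<inter> N 2 0 \<inter> N 0 1 \<inter> N 2 1)" by blast
  moreover have "(deriv ^^ m) (\<lambda>x::real. 0::real) = (\<lambda>x. 0)" for m by (induction m) auto
  then have "f \<in> N k m" for k m using assms by (simp add: N_def schwartz_seminorm_def)
  moreover have "N 0 0 \<inter> N 2 0 \<inter> N 0 1 \<inter> N 2 1 \<subseteq> {g \<in> schwartz. schwartz_bound (\<lambda>x. g x - f x) < e}"
    by (auto simp: N_def schwartz_bound_def)
  ultimately show ?thesis by blast
qed

text \<open>By additivity, continuity at \<open>f\<close> means smallness of \<open>w\<close> at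
  \<open>g - f\<close>, and domination by finitely many seminorms provides a neighbourhood where
  this holds.\<close>

lemma temperedI:
  assumes ext: "w \<in> extensional schwartz"
    and add: "\<And>f g. f \<in> schwartz \<Longrightarrow> g \<in> schwartz \<Longrightarrow> w (\<lambda>x. f x + g x) = w f + w g"
    and cmult: "\<And>c f. f \<in> schwartz \<Longrightarrow> w (\<lambda>x. c * f x) = c * w f"
    and bound: "\<And>f. f \<in> schwartz \<Longrightarrow> \<bar>w f\<bar> \<le> M * schwartz_bound f"
  shows "w \<in> tempered"
proof -
  have "openin schwartz_topology {f \<in> schwartz. w f \<in> U}" if U: "open U" for U
  proof (subst openin_subopen, intro ballI)
    fix f assume "f \<in> {f \<in> schwartz. w f \<in> U}"
    then have f: "f \<in> schwartz" "w f \<in> U" by auto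
    then obtain e where e: "e > 0" "ball (w f) e \<subseteq> U" using U open_contains_ball by blast
    \<comment> \<open>\<open>M\<close> may be zero or negative; \<open>\<bar>M\<bar> + 1\<close> is
      a positive upper bound of it.\<close>
    define d where "d = e / (\<bar>M\<bar> + 1)"
    have d: "d > 0" using e by (simp add: d_def)
    obtain V where V: "openin schwartz_topology V" "f \<in> V"
      "V \<subseteq> {g \<in> schwartz. schwartz_bound (\<lambda>x. g x - f x) < d}"
      using openin_schwartz_bound_ball[OF f(1) d] by blast
    have "w g \<in> U" if "g \<in> V" for g
    proof -
      have g: "g \<in> schwartz" and lt: "schwartz_bound (\<lambda>x. g x - f x) < d" using V that by auto
      have gf: "(\<lambda>x. g x - f x) \<in> schwartz" by (rule schwartz_diff[OF g f(1)])
      have "w g = w (\<lambda>x. (g x - f x) + f x)" by simp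
      also have "\<dots> = w (\<lambda>x. g x - f x) + w f" by (rule add[OF gf f(1)])
      finally have "\<bar>w g - w f\<bar> \<le> M * schwartz_bound (\<lambda>x. g x - f x)" using bound[OF gf] by simp
      also have "\<dots> \<le> (\<bar>M\<bar> + 1) * schwartz_bound (\<lambda>x. g x - f x)"
        by (intro mult_right_mono schwartz_bound_nonneg gf) auto
      also have "\<dots> < (\<bar>M\<bar> + 1) * d" using lt by (intro mult_strict_left_mono) auto
      also have "\<dots> = e" by (simp add: d_def)
      finally show ?thesis using e by (auto simp: subset_iff dist_real_def)
    qed
    then show "\<exists>T. openin schwartz_topology T \<and> f \<in> T \<and> T \<subseteq> {f \<in> schwartz. w f \<in> U}"
      using V by blast
  qed
  then show ?thesis
    using ext add cmult by (auto simp: tempered_def continuous_map_def topspace_schwartz_topology)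
qed

subsection \<open>Uniqueness of measures on tempered distributions\<close>

lemma tempered_add: "w \<in> tempered \<Longrightarrow> f \<in> schwartz \<Longrightarrow> g \<in> schwartz \<Longrightarrow> w (\<lambda>x. f x + g x) = w f + w g"
  and tempered_cmult: "w \<in> tempered \<Longrightarrow> f \<in> schwartz \<Longrightarrow> w (\<lambda>x. c * f x) = c * w f"
  by (auto simp: tempered_def)

lemma measurable_evaluation:
  assumes s: "s \<in> schwartz"
  shows "(\<lambda>w. w s) \<in> borel_measurable tempered_space"
proof (rule measurableI)
  fix A :: "real set" assume A: "A \<in> sets borel"
  define B where "B = {f \<in> space (Pi\<^sub>M {s} (\<lambda>_. borel)). f s \<in> A}"
  have "B \<in> sets (Pi\<^sub>M {s} (\<lambda>_. borel))" unfolding B_def using A by measurable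
  moreover have "{w \<in> tempered. w s \<in> A} = {w \<in> tempered. restrict w {s} \<in> B}"
    by (auto simp: B_def space_PiM)
  ultimately have "{w \<in> tempered. w s \<in> A} \<in> cylinder_sets"
    unfolding cylinder_sets_def using s by blast
  then show "(\<lambda>w. w s) -` A \<inter> space tempered_space \<in> sets tempered_space"
    by (simp add: sets_tempered_space vimage_def Int_def conj_commute sigma_sets.Basic)
qed simp

text \<open>Rectangles are stable under intersection, and their indicators are products of functions
  of single evaluations, so the evaluations can be handled one after another. \<open>A\<close> is
  total and Borel everywhere to spare side conditions outside \<open>J\<close>.\<close>

definition cylinder_boxes :: "((real \<Rightarrow> real) \<Rightarrow> real) set set" where
  "cylinder_boxes = {{w \<in> tempered. \<forall>j\<in>J. w j \<in> A j} | J A.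
     finite J \<and> J \<subseteq> schwartz \<and> (\<forall>j. A j \<in> sets borel)}"

lemma cylinder_boxes_subset: "cylinder_boxes \<subseteq> Pow tempered"
  by (auto simp: cylinder_boxes_def)

text \<open>Measurability of the single evaluations gives measurability of their joint restriction
  to a finite set, so boxes already generate the cylinders over arbitrary bases.\<close>

lemma sets_tempered_space_boxes: "sets tempered_space = sigma_sets tempered cylinder_boxes"
proof (rule antisym)
  have eval: "(\<lambda>w. w s) \<in> borel_measurable (sigma tempered cylinder_boxes)" if s: "s \<in> schwartz" for s
  proof (rule measurableI)
    fix A :: "real set" assume A: "A \<in> sets borel"
    have "{w \<in> tempered. \<forall>j\<in>{s}. w j \<in> A} \<in> cylinder_boxes"
      unfolding cylinder_boxes_def using s A by (intro CollectI exI[of _ "{s}"] exI[of _ "\<lambda>_. A"]) auto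
    then show "(\<lambda>w. w s) -` A \<inter> space (sigma tempered cylinder_boxes) \<in> sets (sigma tempered cylinder_boxes)"
      using cylinder_boxes_subset
      by (simp add: vimage_def Int_def conj_commute sigma_sets.Basic space_measure_of sets_measure_of)
  qed simp
  have "C \<in> sigma_sets tempered cylinder_boxes" if C: "C \<in> cylinder_sets" for C
  proof -
    obtain J B where J: "finite J" "J \<subseteq> schwartz" and B: "B \<in> sets (Pi\<^sub>M J (\<lambda>_. borel))"
      and C_eq: "C = {w \<in> tempered. restrict w J \<in> B}" using C by (auto simp: cylinder_sets_def)
    have "(\<lambda>w. restrict w J) \<in> measurable (sigma tempered cylinder_boxes) (Pi\<^sub>M J (\<lambda>_. borel))"
      using J by (intro measurable_restrict eval) auto
    from measurable_sets[OF this B] show ?thesis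
      using cylinder_boxes_subset
      by (simp add: C_eq vimage_def Int_def conj_commute space_measure_of sets_measure_of)
  qed
  then show "sets tempered_space \<subseteq> sigma_sets tempered cylinder_boxes"
    unfolding sets_tempered_space by (intro sigma_sets_mono) auto
  have "X \<in> sets tempered_space" if X: "X \<in> cylinder_boxes" for X
  proof -
    obtain J A where J: "finite J" "J \<subseteq> schwartz" and A: "\<And>j. A j \<in> sets borel"
      and X_eq: "X = {w \<in> tempered. \<forall>j\<in>J. w j \<in> A j}" using X by (auto simp: cylinder_boxes_def)
    have "{w \<in> space tempered_space. \<forall>j\<in>J. w j \<in> A j} \<in> sets tempered_space"
      using J A measurable_sets[OF measurable_evaluation A]
      by (intro sets.sets_Collect_finite_All) (auto simp: vimage_def Int_def conj_commute)
    then show ?thesis by (simp add: X_eq)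
  qed
  then show "sigma_sets tempered cylinder_boxes \<subseteq> sets tempered_space"
    using sets.sigma_sets_subset[of cylinder_boxes tempered_space] by auto
qed

lemma Int_stable_cylinder_boxes: "Int_stable cylinder_boxes"
proof (rule Int_stableI)
  fix X Y assume "X \<in> cylinder_boxes" "Y \<in> cylinder_boxes"
  then obtain J A K B where
    J: "finite J" "J \<subseteq> schwartz" "\<And>j. A j \<in> sets borel" "X = {w \<in> tempered. \<forall>j\<in>J. w j \<in> A j}" and
    K: "finite K" "K \<subseteq> schwartz" "\<And>j. B j \<in> sets borel" "Y = {w \<in> tempered. \<forall>j\<in>K. w j \<in> B j}"
    by (auto simp: cylinder_boxes_def)
  define D where "D j = (if j \<in> J then A j else UNIV) \<inter> (if j \<in> K then B j else UNIV)" for j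
  have "X \<inter> Y = {w \<in> tempered. \<forall>j\<in>J \<union> K. w j \<in> D j}" by (auto simp: J K D_def)
  moreover have "D j \<in> sets borel" for j using J K by (auto simp: D_def)
  ultimately show "X \<inter> Y \<in> cylinder_boxes"
    unfolding cylinder_boxes_def using J(1,2) K(1,2)
    by (intro CollectI exI[of _ "J \<union> K"] exI[of _ D]) auto
qed

text \<open>Levy's theorem concerns probability measures, so \<open>h\<close> is normalised to a
  density and the laws of \<open>Y\<close> under it are compared. The two normalising constants
  agree by the hypothesis \<open>char\<close> at \<open>t = 0\<close>.\<close>

lemma weighted_char_unique:
  fixes M N :: "'a measure" and h Y :: "'a \<Rightarrow> real"
  assumes M: "prob_space M" and N: "prob_space N" and MN: "sets M = sets N"
    and h[measurable]: "h \<in> borel_measurable M" and Y[measurable]: "Y \<in> borel_measurable M"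
    and h0: "\<And>w. 0 \<le> h w" and hB: "\<And>w. h w \<le> B"
    and char: "\<And>t. (CLINT w|M. of_real (h w) * iexp (t * Y w)) = (CLINT w|N. of_real (h w) * iexp (t * Y w))"
    and A[measurable]: "A \<in> sets borel"
  shows "(LINT w|M. indicator A (Y w) * h w) = (LINT w|N. indicator A (Y w) * h w)"
proof -
  define c where "c = (LINT w|M. h w)"
  have cN: "(LINT w|N. h w) = c"
    using char[of 0] by (simp add: c_def del: of_real_eq_iff) (metis integral_complex_of_real of_real_eq_iff)
  have int: "integrable K h \<and> integrable K (\<lambda>w. indicator A (Y w) * h w)" if K: "prob_space K" and "sets K = sets M" for K
  proof -
    interpret K: prob_space K by (rule K)
    have [measurable_cong]: "sets K = sets M" by fact
    show ?thesis
      using h0 hB by (intro conjI K.integrable_const_bound[where B = B])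
        (auto simp: abs_of_nonneg order_trans[OF h0 hB] split: split_indicator)
  qed
  show ?thesis
  proof (cases "c = 0")
    \<comment> \<open>A weight of total mass 0 cannot be normalised, but then the integral over
      \<open>A\<close> lies between 0 and that mass.\<close>
    case True
    have "(LINT w|K. indicator A (Y w) * h w) = 0" if "prob_space K" "sets K = sets M" "(LINT w|K. h w) = 0" for K
    proof (rule antisym)
      show "(LINT w|K. indicator A (Y w) * h w) \<le> 0"
        unfolding that(3)[symmetric] using int[OF that(1,2)] h0
        by (intro integral_mono) (auto split: split_indicator)
      show "0 \<le> (LINT w|K. indicator A (Y w) * h w)"
        using h0 by (intro Bochner_Integration.integral_nonneg) auto
    qed
    from this[OF M refl] this[OF N MN[symmetric]] show ?thesis using True cN by (simp add: c_def)
  next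
    case False
    have "0 \<le> c" unfolding c_def using h0 by (intro Bochner_Integration.integral_nonneg) auto
    with False have c: "c > 0" by simp
    define D where "D K = distr (density K (\<lambda>w. ennreal (h w / c))) borel Y" for K :: "'a measure"
    have D: "real_distribution (D K)" "char (D K) t = (CLINT w|K. of_real (h w) * iexp (t * Y w)) / of_real c"
        "measure (D K) A = (LINT w|K. indicator A (Y w) * h w) / c"
      if K: "prob_space K" and KM: "sets K = sets M" and Kc: "(LINT w|K. h w) = c" for K t
    proof -
      interpret K: prob_space K by (rule K)
      have [measurable_cong]: "sets K = sets M" by fact
      have "(\<integral>\<^sup>+ w. ennreal (h w / c) \<partial>K) = ennreal (LINT w|K. h w / c)"
        using int[OF K KM] h0 c by (intro nn_integral_eq_integral) auto
      also have "\<dots> = 1" using c Kc by simp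
      finally interpret D': prob_space "density K (\<lambda>w. ennreal (h w / c))"
        by (intro prob_spaceI) (simp add: emeasure_density cong: nn_integral_cong)
      interpret D: prob_space "D K" unfolding D_def by (rule D'.prob_space_distr) measurable
      show "real_distribution (D K)"
        by unfold_locales (auto simp: D_def)
      have "char (D K) t = (CLINT w|density K (\<lambda>w. ennreal (h w / c)). iexp (t * Y w))"
        unfolding char_def D_def by (subst integral_distr) auto
      also have "\<dots> = (CLINT w|K. (h w / c) *\<^sub>R iexp (t * Y w))"
        using h0 c by (subst integral_density) auto
      also have "\<dots> = (CLINT w|K. (of_real (h w) * iexp (t * Y w)) / of_real c)"
        by (intro Bochner_Integration.integral_cong) (auto simp: scaleR_conv_of_real)
      finally show "char (D K) t = (CLINT w|K. of_real (h w) * iexp (t * Y w)) / of_real c" by simp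
      have "measure (D K) A = (LINT x|D K. indicator A x)" by (simp add: D_def)
      also have "\<dots> = (LINT w|density K (\<lambda>w. ennreal (h w / c)). indicator A (Y w))"
        unfolding D_def by (subst integral_distr) auto
      also have "\<dots> = (LINT w|K. (h w / c) *\<^sub>R indicator A (Y w))"
        using h0 c by (subst integral_density) auto
      also have "\<dots> = (LINT w|K. (indicator A (Y w) * h w) / c)"
        by (intro Bochner_Integration.integral_cong) (auto simp: mult.commute)
      finally show "measure (D K) A = (LINT w|K. indicator A (Y w) * h w) / c" by simp
    qed
    have DM: "prob_space M" "sets M = sets M" "(LINT w|M. h w) = c" using M by (auto simp: c_def)
    have DN: "prob_space N" "sets N = sets M" "(LINT w|N. h w) = c" using N MN cN by auto
    have "D M = D N"
      by (rule Levy_uniqueness[OF D(1)[OF DM] D(1)[OF DN]]) (intro ext, simp only: D(2)[OF DM] D(2)[OF DN] char)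
    then show ?thesis using D(3)[OF DM] D(3)[OF DN] c by simp
  qed
qed

lemma bounded_complex_integrable:
  fixes f :: "'a \<Rightarrow> complex"
  assumes "prob_space M" "f \<in> borel_measurable M" "\<And>w. norm (f w) \<le> B"
  shows "integrable M f"
  using assms by (intro finite_measure.integrable_const_bound[where B = B])
    (auto simp: prob_space.finite_measure)

text \<open>Evaluations are conditioned one at a time on a Borel set. The one-dimensional uniqueness theorem is
  applied to the law of \<open>w r\<close> under the nonnegative weights \<open>1 + cos (w s + \<theta>)\<close>, which
  carry the remaining characters \<open>w \<mapsto> e\<^sup>i\<^sup>w\<^sup>s\<close>.\<close>

lemma tempered_box_char_unique:
  assumes P: "prob_space P" "sets P = sets tempered_space"
    and Q: "prob_space Q" "sets Q = sets tempered_space"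
    and char: "\<And>s. s \<in> schwartz \<Longrightarrow> (CLINT w|P. iexp (w s)) = (CLINT w|Q. iexp (w s))"
    and J: "finite J" "J \<subseteq> schwartz" and A: "\<And>j. A j \<in> sets borel" and s: "s \<in> schwartz"
  shows "(CLINT w|P. of_real (\<Prod>j\<in>J. indicator (A j) (w j)) * iexp (w s)) =
         (CLINT w|Q. of_real (\<Prod>j\<in>J. indicator (A j) (w j)) * iexp (w s))"
  using J s
\<comment> \<open>\<open>s\<close> must vary: releasing the condition on \<open>w r\<close> calls
  for the induction hypothesis at t r, s + t r and - s + t r for every real t.\<close>
proof (induction J arbitrary: s rule: finite_induct)
  case empty
  then show ?case using char by simp
next
  case (insert r J)
  define h :: "((real \<Rightarrow> real) \<Rightarrow> real) \<Rightarrow> real" where "h w = (\<Prod>j\<in>J. indicator (A j) (w j))" for w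
  have r: "r \<in> schwartz" and J: "J \<subseteq> schwartz" and s: "s \<in> schwartz" using insert by auto
  have IH: "(CLINT w|P. of_real (h w) * iexp (w u)) = (CLINT w|Q. of_real (h w) * iexp (w u))" if "u \<in> schwartz" for u
    unfolding h_def using insert.IH[OF J that] .
  have h01: "0 \<le> h w" "h w \<le> 1" for w
    unfolding h_def by (auto intro!: prod_nonneg prod_le_1 simp: indicator_def)
  have ev: "(\<lambda>w. f (w u)) \<in> borel_measurable tempered_space"
    if "u \<in> schwartz" "f \<in> borel_measurable borel" for u and f :: "real \<Rightarrow> 'b::topological_space"
    using measurable_compose[OF measurable_evaluation[OF that(1)] that(2)] .
  have h_meas: "h \<in> borel_measurable tempered_space"
    unfolding h_def using J by (intro borel_measurable_prod ev borel_measurable_indicator A) auto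
  have cong: "f \<in> borel_measurable K \<longleftrightarrow> f \<in> borel_measurable tempered_space"
    if "K \<in> {P, Q}" for K and f :: "_ \<Rightarrow> 'b::topological_space"
    using that P Q by (intro arg_cong2[of _ _ _ _ "(\<in>)"] refl measurable_cong_sets) auto
  have sp: "space P = tempered" "space Q = tempered"
    using sets_eq_imp_space_eq[OF P(2)] sets_eq_imp_space_eq[OF Q(2)] by auto
  have int: "integrable K (\<lambda>w. of_real (h w) * iexp (w u))" if K: "K \<in> {P, Q}" and u: "u \<in> schwartz" for K u
  proof (rule bounded_complex_integrable[where B = 1])
    show "prob_space K" using K P Q by auto
    show "(\<lambda>w. of_real (h w) * iexp (w u)) \<in> borel_measurable K"
      unfolding cong[OF K]
      by (intro borel_measurable_times measurable_compose[OF h_meas borel_measurable_of_real] ev[OF u]) measurable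
  qed (use h01 in \<open>auto simp: norm_mult\<close>)
  \<comment> \<open>The phase stays free so that \<theta> = 0 and \<theta> = - pi / 2 give cosine
    and sine, the real and imaginary parts put together in \<open>euler\<close>.\<close>
  have box: "(LINT w|P. indicator (A r) (w r) * (h w * (1 + cos (w s + \<theta>)))) =
      (LINT w|Q. indicator (A r) (w r) * (h w * (1 + cos (w s + \<theta>))))" for \<theta>
  proof (rule weighted_char_unique[where B = 2])
    show "prob_space P" "prob_space Q" "sets P = sets Q" using P Q by auto
    show "(\<lambda>w. h w * (1 + cos (w s + \<theta>))) \<in> borel_measurable P" "(\<lambda>w. w r) \<in> borel_measurable P"
      unfolding cong[of P, simplified]
      by (intro borel_measurable_times h_meas ev[OF s] measurable_evaluation r; measurable)+
    fix w
    have c: "0 \<le> 1 + cos (w s + \<theta>)" "1 + cos (w s + \<theta>) \<le> 2"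
      using cos_ge_minus_one[of "w s + \<theta>"] cos_le_one[of "w s + \<theta>"] by linarith+
    then show "0 \<le> h w * (1 + cos (w s + \<theta>))" using h01 by simp
    show "h w * (1 + cos (w s + \<theta>)) \<le> 2" using mult_mono[OF h01(2) c(2) _ c(1), of w] by simp
  next
    fix t :: real
    have cl: "(\<lambda>x. t * r x) \<in> schwartz" "(\<lambda>x. 1 * s x + t * r x) \<in> schwartz" "(\<lambda>x. (-1) * s x + t * r x) \<in> schwartz"
      by (intro schwartz_add schwartz_cmult r s)+
    \<comment> \<open>Euler's formula removes the cosine and leaves three characters with weight
      \<open>h\<close> alone, each covered by the induction hypothesis. The factors \<open>1\<close>
      and \<open>-1\<close> let additivity and homogeneity of \<open>w\<close> apply to these
      functions as written.\<close>
    have "(CLINT w|K. of_real (h w * (1 + cos (w s + \<theta>))) * iexp (t * w r)) =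
        (CLINT w|K. of_real (h w) * iexp (w (\<lambda>x. t * r x))) +
        (iexp \<theta> / 2 * (CLINT w|K. of_real (h w) * iexp (w (\<lambda>x. 1 * s x + t * r x))) +
         iexp (- \<theta>) / 2 * (CLINT w|K. of_real (h w) * iexp (w (\<lambda>x. (-1) * s x + t * r x))))"
      if K: "K \<in> {P, Q}" for K
    proof -
      have "(CLINT w|K. of_real (h w * (1 + cos (w s + \<theta>))) * iexp (t * w r)) =
        (CLINT w|K. of_real (h w) * iexp (w (\<lambda>x. t * r x)) +
          (iexp \<theta> / 2 * (of_real (h w) * iexp (w (\<lambda>x. 1 * s x + t * r x))) +
           iexp (- \<theta>) / 2 * (of_real (h w) * iexp (w (\<lambda>x. (-1) * s x + t * r x)))))"
      proof (intro Bochner_Integration.integral_cong refl)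
        fix w assume "w \<in> space K"
        then have w: "w \<in> tempered" using K sp by auto
        have e: "w (\<lambda>x. t * r x) = t * w r" "w (\<lambda>x. 1 * s x + t * r x) = w s + t * w r"
            "w (\<lambda>x. (-1) * s x + t * r x) = - w s + t * w r"
          using tempered_add[OF w schwartz_cmult[OF s] schwartz_cmult[OF r]]
            tempered_cmult[OF w s] tempered_cmult[OF w r] by (metis mult_1 mult_minus1)+
        have "complex_of_real (cos (w s + \<theta>)) = (iexp (w s) * iexp \<theta> + iexp (- w s) * iexp (- \<theta>)) / 2"
          by (simp add: cos_exp_eq exp_add[symmetric] algebra_simps flip: cos_of_real)
        then have c: "complex_of_real (h w * (1 + cos (w s + \<theta>))) =
            of_real (h w) * (1 + (iexp (w s) * iexp \<theta> + iexp (- w s) * iexp (- \<theta>)) / 2)"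
          by (simp only: of_real_mult of_real_add of_real_1)
        have i: "iexp (w s + t * w r) = iexp (w s) * iexp (t * w r)"
            "iexp (- w s + t * w r) = iexp (- w s) * iexp (t * w r)"
          by (simp_all add: exp_add[symmetric] algebra_simps)
        have "k * (1 + (a * b + a' * b') / 2) * x = k * x + (b / 2 * (k * (a * x)) + b' / 2 * (k * (a' * x)))"
          for k a b a' b' x :: complex by (simp add: field_simps)
        then show "of_real (h w * (1 + cos (w s + \<theta>))) * iexp (t * w r) =
          of_real (h w) * iexp (w (\<lambda>x. t * r x)) +
          (iexp \<theta> / 2 * (of_real (h w) * iexp (w (\<lambda>x. 1 * s x + t * r x))) +
           iexp (- \<theta>) / 2 * (of_real (h w) * iexp (w (\<lambda>x. (-1) * s x + t * r x))))"
          unfolding e c i by blast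
      qed
      also have "\<dots> = (CLINT w|K. of_real (h w) * iexp (w (\<lambda>x. t * r x))) +
        (iexp \<theta> / 2 * (CLINT w|K. of_real (h w) * iexp (w (\<lambda>x. 1 * s x + t * r x))) +
         iexp (- \<theta>) / 2 * (CLINT w|K. of_real (h w) * iexp (w (\<lambda>x. (-1) * s x + t * r x))))"
        using int[OF K cl(1)] int[OF K cl(2)] int[OF K cl(3)]
        by (subst Bochner_Integration.integral_add; simp?)+
      finally show ?thesis .
    qed
    from this[of P] this[of Q]
    show "(CLINT w|P. of_real (h w * (1 + cos (w s + \<theta>))) * iexp (t * w r)) =
        (CLINT w|Q. of_real (h w * (1 + cos (w s + \<theta>))) * iexp (t * w r))"
      by (simp only: IH[OF cl(1)] IH[OF cl(2)] IH[OF cl(3)] insertI1 insertI2)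
  qed (rule A)
  define g where "g w = indicator (A r) (w r) * h w" for w
  have g_meas: "g \<in> borel_measurable tempered_space"
    unfolding g_def by (intro borel_measurable_times h_meas ev[OF r] borel_measurable_indicator A)
  have g01: "0 \<le> g w" "g w \<le> 1" for w unfolding g_def using h01 by (auto split: split_indicator)
  have gint: "integrable K (\<lambda>w. g w * f w)"
    if K: "K \<in> {P, Q}" and f: "f \<in> borel_measurable tempered_space" "\<And>w. \<bar>f w\<bar> \<le> 1" for K f
  proof -
    interpret K: prob_space K using K P Q by auto
    show ?thesis
    proof (rule K.integrable_const_bound[where B = 1])
      show "(\<lambda>w. g w * f w) \<in> borel_measurable K" 
        unfolding cong[OF K] by (intro borel_measurable_times g_meas f)
      show "AE w in K. norm (g w * f w) \<le> 1"
        using mult_le_one[OF g01(2) _ f(2)] g01 by (auto simp: abs_mult)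
    qed
  qed
  have split: "(LINT w|K. indicator (A r) (w r) * (h w * (1 + cos (w s + \<theta>)))) =
      (LINT w|K. g w) + (LINT w|K. g w * cos (w s + \<theta>))" if K: "K \<in> {P, Q}" for K \<theta>
  proof -
    have "(LINT w|K. g w * 1 + g w * cos (w s + \<theta>)) = (LINT w|K. g w * 1) + (LINT w|K. g w * cos (w s + \<theta>))"
      by (intro Bochner_Integration.integral_add gint K ev[OF s]) auto
    then show ?thesis by (simp add: g_def algebra_simps)
  qed
  \<comment> \<open>This is the contribution of the constant 1 in the weight, to be subtracted from
    \<open>box\<close>.\<close>
  have mass: "(LINT w|P. g w) = (LINT w|Q. g w)"
  proof (unfold g_def, rule weighted_char_unique[where B = 1])
    show "prob_space P" "prob_space Q" "sets P = sets Q" using P Q by auto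
    fix t :: real
    have "(CLINT w|K. of_real (h w) * iexp (t * w r)) = (CLINT w|K. of_real (h w) * iexp (w (\<lambda>x. t * r x)))"
      if "K \<in> {P, Q}" for K
      using that sp by (intro Bochner_Integration.integral_cong refl) (auto simp: tempered_cmult[OF _ r])
    then show "(CLINT w|P. of_real (h w) * iexp (t * w r)) = (CLINT w|Q. of_real (h w) * iexp (t * w r))"
      using IH[OF schwartz_cmult[OF r, of t]] by simp
    show "h \<in> borel_measurable P" "(\<lambda>w. w r) \<in> borel_measurable P"
      unfolding cong[of P, simplified] by (intro h_meas measurable_evaluation r)+
  qed (use h01 A in auto)
  have cos: "(LINT w|P. g w * cos (w s + \<theta>)) = (LINT w|Q. g w * cos (w s + \<theta>))" for \<theta>
    using box[of \<theta>] mass split[of P \<theta>] split[of Q \<theta>] by simp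
  have euler: "(CLINT w|K. of_real (g w) * iexp (w s)) =
      of_real (LINT w|K. g w * cos (w s + 0)) + \<i> * of_real (LINT w|K. g w * cos (w s + (- pi / 2)))"
    if K: "K \<in> {P, Q}" for K
  proof -
    have i1: "integrable K (\<lambda>w. complex_of_real (g w * cos (w s + 0)))"
      and i2: "integrable K (\<lambda>w. complex_of_real (g w * cos (w s + (- pi / 2))))"
      by (intro integrable_of_real gint K ev[OF s]; simp)+
    have "(CLINT w|K. of_real (g w) * iexp (w s)) =
        (CLINT w|K. of_real (g w * cos (w s + 0)) + \<i> * of_real (g w * cos (w s + (- pi / 2))))"
      by (intro Bochner_Integration.integral_cong refl)
         (simp add: cis_conv_exp[symmetric] complex_eq_iff cos_diff)
    also have "\<dots> = (CLINT w|K. of_real (g w * cos (w s + 0))) + \<i> * (CLINT w|K. of_real (g w * cos (w s + (- pi / 2))))"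
      using i1 i2 by (subst Bochner_Integration.integral_add) auto
    finally show ?thesis by (simp only: integral_complex_of_real)
  qed
  have "(CLINT w|P. of_real (g w) * iexp (w s)) = (CLINT w|Q. of_real (g w) * iexp (w s))"
    by (simp only: euler insertI1 insertI2 cos)
  then show ?case unfolding g_def h_def using insert.hyps by simp
qed

text \<open>At the zero test function the character is 1, so the integrals of
  \<open>tempered_box_char_unique\<close> become probabilities of boxes, and these determine the
  measure.\<close>

theorem tempered_char_unique:
  assumes P: "prob_space P" "sets P = sets tempered_space"
    and Q: "prob_space Q" "sets Q = sets tempered_space"
    and char: "\<And>s. s \<in> schwartz \<Longrightarrow> (CLINT w|P. iexp (w s)) = (CLINT w|Q. iexp (w s))"
  shows "P = Q"
proof (rule measure_eqI_generator_eq[OF Int_stable_cylinder_boxes cylinder_boxes_subset])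
  show "sets P = sigma_sets tempered cylinder_boxes" "sets Q = sigma_sets tempered cylinder_boxes"
    using P Q by (auto simp: sets_tempered_space_boxes)
  interpret P: prob_space P by fact
  interpret Q: prob_space Q by fact
  have "{w \<in> tempered. \<forall>j\<in>{}. w j \<in> UNIV} \<in> cylinder_boxes"
    unfolding cylinder_boxes_def by (intro CollectI exI[of _ "{}"] exI[of _ "\<lambda>_. UNIV"]) auto
  then show "range (\<lambda>_::nat. tempered) \<subseteq> cylinder_boxes" by auto
  show "emeasure P tempered \<noteq> \<infinity>" by simp
  fix X assume X: "X \<in> cylinder_boxes"
  then obtain J A where J: "finite J" "J \<subseteq> schwartz" "\<And>j. A j \<in> sets borel"
    and X_eq: "X = {w \<in> tempered. \<forall>j\<in>J. w j \<in> A j}" by (auto simp: cylinder_boxes_def)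
  have sp: "space P = tempered" "space Q = tempered"
    using sets_eq_imp_space_eq[OF P(2)] sets_eq_imp_space_eq[OF Q(2)] by auto
  \<comment> \<open>Homogeneity with factor 0, applied to the zero function, produces the form
    \<open>0 * 0\<close> and the value 0 of \<open>w\<close> there.\<close>
  have meas: "(CLINT w|K. of_real (\<Prod>j\<in>J. indicator (A j) (w j)) * iexp (w (\<lambda>x. 0 * 0))) = of_real (measure K X)"
    if K: "K \<in> {P, Q}" for K
  proof -
    interpret K: prob_space K using K P Q by auto
    have "(CLINT w|K. of_real (\<Prod>j\<in>J. indicator (A j) (w j)) * iexp (w (\<lambda>x. 0 * 0))) = (CLINT w|K. of_real (indicator X w))"
    proof (intro Bochner_Integration.integral_cong refl)
      fix w assume "w \<in> space K"
      then have w: "w \<in> tempered" using K sp by auto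
      have "w (\<lambda>x. 0 * 0) = 0" using tempered_cmult[OF w schwartz_zero, of 0] by simp
      moreover have "(\<Prod>j\<in>J. indicator (A j) (w j)) = (indicator X w :: real)"
        using J(1) w by (auto simp: X_eq indicator_def prod.If_cases)
      ultimately show "of_real (\<Prod>j\<in>J. indicator (A j) (w j)) * iexp (w (\<lambda>x. 0 * 0)) = complex_of_real (indicator X w)"
        by simp
    qed
    moreover have "X \<in> sets K" using K P Q X by (auto simp: sets_tempered_space_boxes)
    then have "X \<inter> space K = X" by (simp add: sets.Int_space_eq2)
    ultimately show ?thesis by simp
  qed
  have "measure P X = measure Q X"
    using tempered_box_char_unique[OF P Q char J, of "\<lambda>x. 0 * 0"] meas[of P] meas[of Q] schwartz_zero by simp
  then show "emeasure P X = emeasure Q X" by (simp add: P.emeasure_eq_measure Q.emeasure_eq_measure)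
qed auto

subsection \<open>Haar coefficients on the unit interval\<close>

text \<open>Closed cells suit integration over intervals; neighbours share an endpoint, which the
  integral does not see.\<close>

definition dyadic_cell :: "nat \<Rightarrow> nat \<Rightarrow> real set" where
  "dyadic_cell j i = {real i / 2 ^ j .. real (Suc i) / 2 ^ j}"

definition cell_integral :: "nat \<Rightarrow> nat \<Rightarrow> (real \<Rightarrow> real) \<Rightarrow> real" where
  "cell_integral j i u = integral (dyadic_cell j i) u"

text \<open>Index \<open>j = 0\<close> stands for the constant function (\<open>j - 1\<close> truncates to 0), \<open>j \<ge> 1\<close> for the wavelets
  of generation \<open>j - 1\<close>. The value 0 for \<open>i \<ge> 2\<^sup>j\<^sup>-\<^sup>1\<close> makes the index set a full type.\<close>

definition haar_coeff :: "nat \<Rightarrow> nat \<Rightarrow> (real \<Rightarrow> real) \<Rightarrow> real" where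
  "haar_coeff j i u = (if i \<ge> 2 ^ (j - 1) then 0 else if j = 0 then cell_integral 0 0 u
     else sqrt 2 ^ (j - 1) * (cell_integral j (2 * i) u - cell_integral j (2 * i + 1) u))"

text \<open>With k = j - 1, \<open>sqrt 2 ^ k\<close> is the height of an L^2-normalised wavelet on
  an interval of length 2^(-k), and \<open>(1 / 4) ^ k\<close> is the order of length times
  oscillation of a Lipschitz function there.\<close>

definition haar_weight :: "nat \<Rightarrow> nat \<Rightarrow> real" where
  "haar_weight j i = (if i \<ge> 2 ^ (j - 1) then 0 else sqrt 2 ^ (j - 1) * (1 / 4) ^ (j - 1))"

lemma dyadic_cell_subset:
  assumes "i < 2 ^ j"
  shows "dyadic_cell j i \<subseteq> {0..1}"
proof -
  have "real (Suc i) \<le> 2 ^ j" using assms by (metis Suc_leI of_nat_le_iff of_nat_numeral of_nat_power)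
  then show ?thesis by (auto simp: dyadic_cell_def field_simps intro: order_trans)
qed

lemma dyadic_cell_integrable:
  fixes u :: "real \<Rightarrow> real"
  assumes "continuous_on {0..1} u" "i < 2 ^ j"
  shows "u integrable_on dyadic_cell j i"
  using continuous_on_subset[OF assms(1) dyadic_cell_subset[OF assms(2)]]
  unfolding dyadic_cell_def by (rule integrable_continuous_real)

lemma cell_integral_split:
  assumes "continuous_on {0..1} u" "i < 2 ^ j"
  shows "cell_integral j i u = cell_integral (Suc j) (2 * i) u + cell_integral (Suc j) (2 * i + 1) u"
proof -
  have "integral {real i / 2 ^ j .. real (2 * i + 1) / 2 ^ Suc j} u + integral {real (2 * i + 1) / 2 ^ Suc j .. real (Suc i) / 2 ^ j} u
      = integral {real i / 2 ^ j .. real (Suc i) / 2 ^ j} u"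
    using dyadic_cell_integrable[OF assms]
    by (intro Henstock_Kurzweil_Integration.integral_combine) (auto simp: dyadic_cell_def field_simps)
  moreover have "real (2 * i) / 2 ^ Suc j = real i / 2 ^ j" "real (Suc (2 * i + 1)) / 2 ^ Suc j = real (Suc i) / 2 ^ j"
    by (auto simp: field_simps)
  ultimately show ?thesis by (simp add: cell_integral_def dyadic_cell_def)
qed

lemma cell_integral_near:
  assumes u: "continuous_on {0..1} u" and i: "i < 2 ^ j"
    and B: "\<And>x. x \<in> dyadic_cell j i \<Longrightarrow> \<bar>u x - c\<bar> \<le> B"
  shows "\<bar>cell_integral j i u - c / 2 ^ j\<bar> \<le> B / 2 ^ j"
proof -
  have B0: "0 \<le> B" using B[of "real i / 2 ^ j"] by (force simp: dyadic_cell_def field_simps)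
  have "norm (integral (cbox (real i / 2 ^ j) (real (Suc i) / 2 ^ j)) (\<lambda>x. u x - c)) \<le>
      B * measure lborel (cbox (real i / 2 ^ j) (real (Suc i) / 2 ^ j))"
    using B B0 dyadic_cell_integrable[OF u i]
    by (intro integrable_bound integrable_diff) (auto simp: dyadic_cell_def)
  moreover have "integral (dyadic_cell j i) (\<lambda>x. u x - c) = cell_integral j i u - c / 2 ^ j"
    unfolding cell_integral_def using dyadic_cell_integrable[OF u i]
    by (subst integral_diff) (auto simp: dyadic_cell_def field_simps)
  moreover have "B * measure lborel (cbox (real i / 2 ^ j) (real (Suc i) / 2 ^ j)) = B / 2 ^ j"
    by (simp add: divide_right_mono add_divide_distrib)
  ultimately show ?thesis by (simp add: dyadic_cell_def)
qed

text \<open>A wavelet has mean zero: both half cells are compared with the same constant, which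
  cancels in the difference, so only the oscillation of \<open>u\<close> remains.\<close>

lemma haar_coeff_bound:
  assumes lip: "\<And>x y. x \<in> {0..1} \<Longrightarrow> y \<in> {0..1} \<Longrightarrow> \<bar>u x - u y\<bar> \<le> B * \<bar>x - y\<bar>"
    and bnd: "\<And>x. x \<in> {0..1} \<Longrightarrow> \<bar>u x\<bar> \<le> B"
    and u: "continuous_on {0..1} u"
  shows "\<bar>haar_coeff j i u\<bar> \<le> B * haar_weight j i"
proof (cases j)
  case 0
  have "\<bar>cell_integral 0 0 u - 0 / 2 ^ 0\<bar> \<le> B / 2 ^ 0"
    by (rule cell_integral_near[OF u]) (auto simp: bnd dyadic_cell_def)
  then show ?thesis using 0 by (simp add: haar_coeff_def haar_weight_def)
next
  case (Suc k)
  have B0: "0 \<le> B" using bnd[of 0] by simp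
  show ?thesis
  proof (cases "i < 2 ^ k")
    case True
    define h :: real where "h = 1 / 2 ^ j"
    \<comment> \<open>The common endpoint of the two half cells, within distance \<open>h\<close> of
      every point of either.\<close>
    define m where "m = real (2 * i + 1) / 2 ^ j"
    have i: "2 * i < 2 ^ j" "2 * i + 1 < 2 ^ j" using True Suc by auto
    have m: "m \<in> {0..1}"
      using dyadic_cell_subset[OF i(2)] by (auto simp: m_def dyadic_cell_def subset_iff divide_right_mono)
    have near: "\<bar>cell_integral j l u - u m / 2 ^ j\<bar> \<le> (B * h) / 2 ^ j" if l: "l \<in> {2 * i, 2 * i + 1}" for l
    proof (rule cell_integral_near[OF u])
      show lj: "l < 2 ^ j" using i l by auto
      fix x assume x: "x \<in> dyadic_cell j l"
      then have "\<bar>x - m\<bar> \<le> h" using l by (auto simp: dyadic_cell_def m_def h_def field_simps abs_le_iff)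
      then have "B * \<bar>x - m\<bar> \<le> B * h" using B0 by (rule mult_left_mono)
      moreover have "x \<in> {0..1}" using dyadic_cell_subset[OF lj] x by auto
      ultimately show "\<bar>u x - u m\<bar> \<le> B * h" using lip[OF _ m, of x] by linarith
    qed
    have "\<bar>cell_integral j (2 * i) u - cell_integral j (2 * i + 1) u\<bar> \<le> 2 * ((B * h) / 2 ^ j)"
      using near[of "2 * i"] near[of "2 * i + 1"] by (simp add: abs_le_iff)
    also have "\<dots> \<le> B * (1 / 4) ^ k"
      using B0 by (simp add: h_def Suc field_simps power_mult_distrib[symmetric])
    finally have "sqrt 2 ^ k * \<bar>cell_integral j (2 * i) u - cell_integral j (2 * i + 1) u\<bar> \<le> sqrt 2 ^ k * (B * (1 / 4) ^ k)"
      by (intro mult_left_mono) auto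
    then show ?thesis using True Suc by (simp add: haar_coeff_def haar_weight_def abs_mult mult_ac)
  next
    case False
    then show ?thesis using Suc by (simp add: haar_coeff_def haar_weight_def)
  qed
qed

lemma haar_coeff_add:
  assumes "continuous_on {0..1} u" "continuous_on {0..1} v"
  shows "haar_coeff j i (\<lambda>x. u x + v x) = haar_coeff j i u + haar_coeff j i v"
proof -
  have "cell_integral j l (\<lambda>x. u x + v x) = cell_integral j l u + cell_integral j l v" if "l < 2 ^ j" for l
    unfolding cell_integral_def by (intro integral_add dyadic_cell_integrable assms that)
  moreover have "2 * i + 1 < 2 ^ j" if "i < 2 ^ (j - 1)" "j \<noteq> 0" using that by (cases j) auto
  ultimately show ?thesis by (auto simp: haar_coeff_def algebra_simps)
qed

lemma haar_coeff_cmult: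
  "haar_coeff j i (\<lambda>x. c * u x) = c * haar_coeff j i u"
proof -
  have "cell_integral j l (\<lambda>x. c * u x) = c * cell_integral j l u" for j l
    by (simp add: cell_integral_def)
  then show ?thesis by (simp add: haar_coeff_def algebra_simps)
qed

section \<open>Parseval's identity on the unit interval\<close>

lemma sum_dyadic_split:
  fixes f :: "nat \<Rightarrow> real"
  shows "(\<Sum>i<2 ^ Suc j. f i) = (\<Sum>i<2 ^ j. f (2 * i) + f (2 * i + 1))"
  using sum_split_even_odd[of f f "2 ^ j"] by (simp add: sum.distrib)

lemma sum_cell_integral:
  assumes "continuous_on {0..1} u"
  shows "(\<Sum>i<2 ^ j. cell_integral j i u) = integral {0..1} u"
proof (induction j)
  case (Suc j)
  have "(\<Sum>i<2 ^ Suc j. cell_integral (Suc j) i u) = (\<Sum>i<2 ^ j. cell_integral j i u)"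
    unfolding sum_dyadic_split by (intro sum.cong refl cell_integral_split[symmetric] assms) auto
  then show ?case using Suc by simp
qed (simp add: cell_integral_def dyadic_cell_def)

text \<open>Passing from one generation of cells to the next adds the Haar coefficients of that
  generation, by the parallelogram identity \<open>2 a\<^sup>2 + 2 b\<^sup>2 = (a + b)\<^sup>2 + (a - b)\<^sup>2\<close>.\<close>

lemma sum_haar_coeff_squared:
  assumes "continuous_on {0..1} u"
  shows "(\<Sum>j\<le>N. \<Sum>i<2 ^ (j - 1). (haar_coeff j i u)\<^sup>2) = (\<Sum>i<2 ^ N. 2 ^ N * (cell_integral N i u)\<^sup>2)"
proof (induction N)
  case 0
  show ?case by (simp add: haar_coeff_def)
next
  case (Suc N)
  have "(\<Sum>i<2 ^ N. (haar_coeff (Suc N) i u)\<^sup>2) + (\<Sum>i<2 ^ N. 2 ^ N * (cell_integral N i u)\<^sup>2) =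
      (\<Sum>i<2 ^ N. 2 ^ Suc N * (cell_integral (Suc N) (2 * i) u)\<^sup>2 + 2 ^ Suc N * (cell_integral (Suc N) (2 * i + 1) u)\<^sup>2)"
    unfolding sum.distrib[symmetric]
  proof (intro sum.cong refl)
    fix i assume i: "i \<in> {..<2 ^ N :: nat}"
    have "(sqrt 2 ^ N)\<^sup>2 = ((sqrt 2)\<^sup>2) ^ N" by (simp only: power_mult[symmetric] mult.commute)
    then have "(sqrt 2 ^ N)\<^sup>2 = (2::real) ^ N" by simp
    then have "(sqrt 2 ^ N * (a - b))\<^sup>2 + 2 ^ N * (a + b)\<^sup>2 = 2 ^ Suc N * a\<^sup>2 + 2 ^ Suc N * b\<^sup>2" for a b :: real
      unfolding power_mult_distrib by (simp add: power2_sum power2_diff algebra_simps)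
    then show "(haar_coeff (Suc N) i u)\<^sup>2 + 2 ^ N * (cell_integral N i u)\<^sup>2 =
        2 ^ Suc N * (cell_integral (Suc N) (2 * i) u)\<^sup>2 + 2 ^ Suc N * (cell_integral (Suc N) (2 * i + 1) u)\<^sup>2"
      using i cell_integral_split[OF assms, of i N] by (simp add: haar_coeff_def)
  qed
  then show ?case unfolding sum_dyadic_split using Suc by simp
qed

text \<open>The difference is the integral over the cell of the squared deviation of
  \<open>u\<close> from its mean. It does not change when a constant is subtracted, so
  \<open>u\<close> is replaced by its deviation from the value at the left endpoint, at most
  \<open>B / 2 ^ j\<close>. The factor 2 comes from bounding the two terms separately.\<close>

lemma cell_integral_variance:
  assumes lip: "\<And>x y. x \<in> {0..1} \<Longrightarrow> y \<in> {0..1} \<Longrightarrow> \<bar>u x - u y\<bar> \<le> B * \<bar>x - y\<bar>"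
    and B: "B \<ge> 0" and u: "continuous_on {0..1} u" and i: "i < 2 ^ j"
  shows "\<bar>cell_integral j i (\<lambda>x. (u x)\<^sup>2) - 2 ^ j * (cell_integral j i u)\<^sup>2\<bar> \<le> 2 * (B / 2 ^ j)\<^sup>2 / 2 ^ j"
proof -
  define a where "a = real i / 2 ^ j"
  have a: "a \<in> dyadic_cell j i" by (simp add: a_def dyadic_cell_def divide_right_mono)
  have a01: "a \<in> {0..1}" using a dyadic_cell_subset[OF i] by blast
  have osc: "\<bar>u x - u a\<bar> \<le> B / 2 ^ j" if "x \<in> dyadic_cell j i" for x
  proof -
    have "\<bar>x - a\<bar> \<le> 1 / 2 ^ j" using that by (auto simp: a_def dyadic_cell_def add_divide_distrib abs_le_iff)
    then have "B * \<bar>x - a\<bar> \<le> B * (1 / 2 ^ j)" using B by (rule mult_left_mono)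
    then show ?thesis using lip[OF _ a01, of x] dyadic_cell_subset[OF i] that by force
  qed
  define v where "v x = u x - u a" for x
  have v: "continuous_on {0..1} v" unfolding v_def by (intro continuous_intros u)
  have v2: "continuous_on {0..1} (\<lambda>x. (v x)\<^sup>2)" by (intro continuous_intros v)
  have 1: "\<bar>cell_integral j i v - 0 / 2 ^ j\<bar> \<le> (B / 2 ^ j) / 2 ^ j"
    by (rule cell_integral_near[OF v i]) (use osc in \<open>simp add: v_def\<close>)
  have 2: "\<bar>cell_integral j i (\<lambda>x. (v x)\<^sup>2) - 0 / 2 ^ j\<bar> \<le> (B / 2 ^ j)\<^sup>2 / 2 ^ j"
    by (rule cell_integral_near[OF v2 i]) (use power_mono[OF osc, of _ 2] in \<open>simp add: v_def\<close>)
  have eq1: "cell_integral j i u = cell_integral j i v + u a / 2 ^ j"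
    unfolding cell_integral_def v_def using dyadic_cell_integrable[OF u i]
    by (subst integral_diff) (auto simp: dyadic_cell_def field_simps)
  have "cell_integral j i (\<lambda>x. (u x)\<^sup>2) = cell_integral j i (\<lambda>x. (v x)\<^sup>2 + (2 * u a * v x + (u a)\<^sup>2))"
    by (rule arg_cong[of _ _ "cell_integral j i"]) (simp add: v_def fun_eq_iff power2_eq_square algebra_simps)
  also have "\<dots> = cell_integral j i (\<lambda>x. (v x)\<^sup>2) + (2 * u a * cell_integral j i v + (u a)\<^sup>2 / 2 ^ j)"
    unfolding cell_integral_def using dyadic_cell_integrable[OF v i] dyadic_cell_integrable[OF v2 i]
    by (subst integral_add integral_mult_right; (intro integrable_add integrable_on_mult_right)?; auto simp: dyadic_cell_def field_simps)+
  finally have eq2: "cell_integral j i (\<lambda>x. (u x)\<^sup>2) - 2 ^ j * (cell_integral j i u)\<^sup>2 =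
      cell_integral j i (\<lambda>x. (v x)\<^sup>2) - 2 ^ j * (cell_integral j i v)\<^sup>2"
    unfolding eq1 by (simp add: power2_sum power2_eq_square field_simps)
  have "2 ^ j * (cell_integral j i v)\<^sup>2 \<le> 2 ^ j * ((B / 2 ^ j) / 2 ^ j)\<^sup>2"
    using power_mono[OF 1, of 2] by (intro mult_left_mono) auto
  also have "\<dots> = (B / 2 ^ j)\<^sup>2 / 2 ^ j" by (simp add: power2_eq_square)
  finally have "2 ^ j * (cell_integral j i v)\<^sup>2 \<le> (B / 2 ^ j)\<^sup>2 / 2 ^ j" .
  moreover have "0 \<le> 2 ^ j * (cell_integral j i v)\<^sup>2" by simp
  moreover have "2 * (B / 2 ^ j)\<^sup>2 / 2 ^ j = (B / 2 ^ j)\<^sup>2 / 2 ^ j + (B / 2 ^ j)\<^sup>2 / 2 ^ j" by simp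
  ultimately show ?thesis using 2 unfolding eq2 abs_le_iff by linarith
qed

text \<open>By \<open>sum_haar_coeff_squared\<close> the error of the partial sum up to N is a sum
  of 2^N cell variances, each of order 8^(-N). The Lipschitz bound thus gives completeness with the
  explicit rate 4^(-N).\<close>

lemma haar_parseval:
  assumes lip: "\<And>x y. x \<in> {0..1} \<Longrightarrow> y \<in> {0..1} \<Longrightarrow> \<bar>u x - u y\<bar> \<le> B * \<bar>x - y\<bar>"
    and B: "B \<ge> 0" and u: "continuous_on {0..1} u"
  shows "(\<lambda>j. \<Sum>i<2 ^ (j - 1). (haar_coeff j i u)\<^sup>2) sums integral {0..1} (\<lambda>x. (u x)\<^sup>2)"
  unfolding sums_def_le sum_haar_coeff_squared[OF u]
proof (rule LIM_zero_cancel, rule Lim_null_comparison)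
  have u2: "continuous_on {0..1} (\<lambda>x. (u x)\<^sup>2)" by (intro continuous_intros u)
  show "\<forall>\<^sub>F N in sequentially. norm ((\<Sum>i<2 ^ N. 2 ^ N * (cell_integral N i u)\<^sup>2) - integral {0..1} (\<lambda>x. (u x)\<^sup>2)) \<le> 2 * B\<^sup>2 * (1 / 4) ^ N"
  proof (rule always_eventually, rule allI)
    fix N
    have "\<bar>(\<Sum>i<2 ^ N. cell_integral N i (\<lambda>x. (u x)\<^sup>2) - 2 ^ N * (cell_integral N i u)\<^sup>2)\<bar>
        \<le> (\<Sum>i<(2::nat) ^ N. 2 * (B / 2 ^ N)\<^sup>2 / 2 ^ N)"
      by (rule order_trans[OF sum_abs], rule sum_mono, rule cell_integral_variance[OF lip B u]) auto
    also have "\<dots> = 2 * B\<^sup>2 * (1 / 4) ^ N"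
    proof -
      have "(2 ^ N)\<^sup>2 = (4::real) ^ N" by (simp add: power2_eq_square power_mult_distrib[symmetric])
      then show ?thesis by (simp add: power_divide)
    qed
    finally show "norm ((\<Sum>i<2 ^ N. 2 ^ N * (cell_integral N i u)\<^sup>2) - integral {0..1} (\<lambda>x. (u x)\<^sup>2)) \<le> 2 * B\<^sup>2 * (1 / 4) ^ N"
      unfolding sum_subtractf sum_cell_integral[OF u2] by (simp add: abs_minus_commute)
  qed
  show "(\<lambda>N. 2 * B\<^sup>2 * (1 / 4) ^ N) \<longlonglongrightarrow> 0"
    by (intro tendsto_mult_right_zero LIMSEQ_power_zero) simp
qed

text \<open>With k = j - 1 there are 2^k wavelets of weight 2^(-3k/2); the resulting ratio sqrt 2 /
  2 is below 1, so the weights are summable over all generations.\<close>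

lemma haar_weight_row: "(\<Sum>i<2 ^ (j - 1). haar_weight j i) = (sqrt 2 / 2) ^ (j - 1)"
proof -
  have "2 ^ k * (sqrt 2 ^ k * (1 / 4) ^ k) = (sqrt 2 / 2) ^ k" for k
    by (simp add: power_mult_distrib[symmetric])
  then show ?thesis by (simp add: haar_weight_def)
qed

subsection \<open>Haar coefficients on the line\<close>

text \<open>Tonelli's theorem for unordered sums: nonnegativity supplies the summability on the
  product that is needed to identify its sum with the iterated one.\<close>

lemma nonneg_has_sum_prod:
  fixes f :: "'a \<times> 'b \<Rightarrow> real"
  assumes f: "\<And>x. ((\<lambda>y. f (x, y)) has_sum g x) UNIV" and g: "(g has_sum S) UNIV" and nn: "\<And>p. f p \<ge> 0"
  shows "(f has_sum S) UNIV"
proof -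
  have "f summable_on (SIGMA x:UNIV. UNIV)"
    by (rule summable_on_SigmaI[OF f]) (use g nn in \<open>auto simp: summable_on_def\<close>)
  from has_sum_SigmaI[OF f g this] show ?thesis by simp
qed

lemma has_sum_initial_segment:
  fixes f :: "nat \<Rightarrow> real"
  assumes "\<And>i. i \<ge> n \<Longrightarrow> f i = 0"
  shows "(f has_sum (\<Sum>i<n. f i)) UNIV"
  using has_sum_cong_neutral[of UNIV "{..<n}" f f "\<Sum>i<n. f i"] has_sum_finite[of "{..<n}" f] assms
  by auto

text \<open>\<open>int_decode\<close> enumerates the unit intervals by natural numbers; the weight
  is the Schwartz decay rate at the left endpoint.\<close>

definition unit_weight :: "nat \<Rightarrow> real" where
  "unit_weight m = 1 / (1 + (real_of_int (int_decode m))\<^sup>2)"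

definition wavelet_coeff :: "(real \<Rightarrow> real) \<Rightarrow> nat \<times> nat \<times> nat \<Rightarrow> real" where
  "wavelet_coeff s = (\<lambda>(m, j, i). haar_coeff j i (\<lambda>x. s (of_int (int_decode m) + x)))"

text \<open>The constant 3 comes from \<open>inverse_square_shift\<close>, which moves the decay
  rate from a point of a unit interval to its left endpoint.\<close>

definition wavelet_weight :: "nat \<times> nat \<times> nat \<Rightarrow> real" where
  "wavelet_weight = (\<lambda>(m, j, i). 3 * unit_weight m * haar_weight j i)"

lemma unit_weight_pos: "unit_weight m > 0"
  by (simp add: unit_weight_def add_pos_nonneg)

text \<open>\<open>int_decode\<close> alternates between the two sides of the origin, so the
  absolute value of the \<open>m\<close>-th integer is about m / 2; this permits comparison with
  inverse squares.\<close>

lemma unit_weight_le: "unit_weight m \<le> 8 * (1 / real (Suc m) ^ 2)"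
proof -
  define l where "l = real_of_int (int_decode m)"
  have "real (Suc m) ^ 2 \<le> 8 * (1 + l\<^sup>2)"
  proof (cases "even m")
    case True
    then obtain p where m: "m = 2 * p" by (elim evenE)
    have "l = real p" by (simp add: l_def m int_decode_def sum_decode_def)
    moreover have "(real (2 * p) + 1)\<^sup>2 \<le> 8 * (1 + (real p)\<^sup>2)"
      using sum_squares_bound[of "2 * real p" 1] by (simp add: power2_eq_square algebra_simps)
    ultimately show ?thesis by (simp add: m add.commute)
  next
    case False
    then obtain p where m: "m = 2 * p + 1" by (elim oddE)
    have "l = - real p - 1" by (simp add: l_def m int_decode_def sum_decode_def)
    moreover have "(real (2 * p) + 2)\<^sup>2 \<le> 8 * (1 + (- real p - 1)\<^sup>2)"
      by (simp add: power2_eq_square algebra_simps)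
    ultimately show ?thesis by (simp add: m add.commute)
  qed
  moreover have "1 + l\<^sup>2 > 0" by (simp add: add_pos_nonneg)
  ultimately show ?thesis by (simp add: unit_weight_def l_def[symmetric] field_simps)
qed

lemma summable_unit_weight: "summable unit_weight"
proof (rule summable_comparison_test)
  show "\<exists>N. \<forall>m\<ge>N. norm (unit_weight m) \<le> 8 * (1 / real (Suc m) ^ 2)"
    using unit_weight_le unit_weight_pos[THEN less_imp_le] by (simp add: abs_of_nonneg)
  show "summable (\<lambda>m. 8 * (1 / real (Suc m) ^ 2))"
    using inverse_squares_sums by (intro summable_mult) (auto simp: sums_iff add.commute)
qed

lemma haar_weight_nonneg: "0 \<le> haar_weight j i"
  by (simp add: haar_weight_def)

lemma summable_on_haar_weight: "(\<lambda>(j, i). haar_weight j i) summable_on UNIV"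
proof -
  have "summable (\<lambda>j. (sqrt 2 / 2) ^ (j - 1))"
    by (subst summable_Suc_iff[symmetric]) (auto intro!: summable_geometric simp: real_sqrt_less_iff sqrt2_less_2)
  then have "((\<lambda>j. (sqrt 2 / 2) ^ (j - 1)) has_sum (\<Sum>j. (sqrt 2 / 2) ^ (j - 1))) UNIV"
    by (intro sums_nonneg_imp_has_sum) (auto simp: summable_sums)
  moreover have "((\<lambda>i. case (j, i) of (j, i) \<Rightarrow> haar_weight j i) has_sum (sqrt 2 / 2) ^ (j - 1)) UNIV" for j
  proof -
    have "(haar_weight j has_sum (\<Sum>i<2 ^ (j - 1). haar_weight j i)) UNIV"
      by (rule has_sum_initial_segment) (simp add: haar_weight_def)
    then show ?thesis by (simp only: haar_weight_row prod.case)
  qed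
  ultimately have "((\<lambda>(j, i). haar_weight j i) has_sum (\<Sum>j. (sqrt 2 / 2) ^ (j - 1))) UNIV"
    by (intro nonneg_has_sum_prod[of _ "\<lambda>j. (sqrt 2 / 2) ^ (j - 1)"]) (auto simp: haar_weight_nonneg)
  then show ?thesis by (auto simp: summable_on_def)
qed

lemma summable_on_wavelet_weight: "wavelet_weight summable_on UNIV"
proof -
  obtain S where S: "((\<lambda>(j, i). haar_weight j i) has_sum S) UNIV"
    using summable_on_haar_weight by (auto simp: summable_on_def)
  have outer: "((\<lambda>m. 3 * unit_weight m * S) has_sum (3 * (\<Sum>m. unit_weight m) * S)) UNIV"
    using summable_unit_weight unit_weight_pos
    by (intro has_sum_cmult_left has_sum_cmult_right sums_nonneg_imp_has_sum summable_sums) (auto intro: less_imp_le)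
  have inner: "((\<lambda>p. wavelet_weight (m, p)) has_sum (3 * unit_weight m * S)) UNIV" for m
    using has_sum_cmult_right[OF S, of "3 * unit_weight m"] by (simp add: wavelet_weight_def case_prod_unfold)
  have "(wavelet_weight has_sum (3 * (\<Sum>m. unit_weight m) * S)) UNIV"
    by (rule nonneg_has_sum_prod[OF inner outer])
       (auto simp: wavelet_weight_def haar_weight_nonneg unit_weight_pos[THEN less_imp_le])
  then show ?thesis by (auto simp: summable_on_def)
qed

lemma inverse_square_shift:
  fixes l x :: real
  assumes "x \<in> {0..1}"
  shows "1 / (1 + (l + x)\<^sup>2) \<le> 3 * (1 / (1 + l\<^sup>2))"
proof -
  \<comment> \<open>A rearrangement of 0 \<le> (l + 2 x)^2.\<close>
  have "l\<^sup>2 \<le> 2 * (l + x)\<^sup>2 + 2 * x\<^sup>2"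
    using zero_le_power2[of "l + 2 * x"] by (simp add: power2_eq_square algebra_simps)
  moreover have "x\<^sup>2 \<le> 1" using assms by (simp add: power_le_one)
  moreover have "1 + a \<le> 3 * (1 + b)" if "a \<le> 2 * b + 2 * c" "c \<le> 1" "0 \<le> b" for a b c :: real
    using that by (simp add: algebra_simps)
  ultimately have "1 + l\<^sup>2 \<le> 3 * (1 + (l + x)\<^sup>2)"
    using zero_le_power2[of "l + x"] by blast
  moreover have "1 + l\<^sup>2 > 0" "1 + (l + x)\<^sup>2 > 0" by (simp_all add: add_pos_nonneg)
  ultimately show ?thesis by (simp add: field_simps)
qed

context
  fixes s :: "real \<Rightarrow> real" and m :: nat
  assumes s: "s \<in> schwartz"
begin

text \<open>Size and slope receive the same bound because \<open>haar_coeff_bound\<close> uses a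
  single constant for both.\<close>

lemma schwartz_shift_bound:
  assumes x: "x \<in> {0..1}"
  shows "\<bar>s (of_int (int_decode m) + x)\<bar> \<le> 3 * unit_weight m * schwartz_bound s"
    and "\<bar>deriv s (of_int (int_decode m) + x)\<bar> \<le> 3 * unit_weight m * schwartz_bound s"
proof -
  have "schwartz_bound s * (1 / (1 + (of_int (int_decode m) + x)\<^sup>2)) \<le> schwartz_bound s * (3 * unit_weight m)"
    unfolding unit_weight_def using inverse_square_shift[OF x] schwartz_bound_nonneg[OF s] by (rule mult_left_mono)
  then show "\<bar>s (of_int (int_decode m) + x)\<bar> \<le> 3 * unit_weight m * schwartz_bound s"
    "\<bar>deriv s (of_int (int_decode m) + x)\<bar> \<le> 3 * unit_weight m * schwartz_bound s"
    using schwartz_decay[OF s, of "of_int (int_decode m) + x"] by (simp_all add: mult_ac)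
qed

lemma schwartz_shift_lipschitz:
  assumes "x \<in> {0..1}" "y \<in> {0..1}"
  shows "\<bar>s (of_int (int_decode m) + x) - s (of_int (int_decode m) + y)\<bar> \<le> 3 * unit_weight m * schwartz_bound s * \<bar>x - y\<bar>"
proof -
  have "norm (s (of_int (int_decode m) + x) - s (of_int (int_decode m) + y)) \<le> 3 * unit_weight m * schwartz_bound s * norm (x - y)"
  proof (rule field_differentiable_bound[where S = "{0..1}" and f' = "\<lambda>x. deriv s (of_int (int_decode m) + x)"])
    fix z :: real assume "z \<in> {0..1}"
    then show "norm (deriv s (of_int (int_decode m) + z)) \<le> 3 * unit_weight m * schwartz_bound s"
      using schwartz_shift_bound(2) by simp
    have "((\<lambda>x. s (x + of_int (int_decode m))) has_real_derivative deriv s (z + of_int (int_decode m))) (at z)"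
      using schwartz_has_derivative[OF s] by (subst DERIV_shift[symmetric]) 
    then show "((\<lambda>x. s (of_int (int_decode m) + x)) has_real_derivative deriv s (of_int (int_decode m) + z)) (at z within {0..1})"
      by (simp add: add.commute has_field_derivative_at_within)
  qed (use assms in auto)
  then show ?thesis by simp
qed

lemma schwartz_shift_continuous: "continuous_on A (\<lambda>x. s (of_int (int_decode m) + x))"
  by (rule continuous_on_compose2[OF schwartz_continuous_on[OF s, of UNIV]]) (auto intro!: continuous_intros)

end

lemma wavelet_coeff_bound:
  assumes s: "s \<in> schwartz"
  shows "\<bar>wavelet_coeff s q\<bar> \<le> schwartz_bound s * wavelet_weight q"
proof -
  obtain m j i where q: "q = (m, j, i)" by (cases q)
  show ?thesis
    using haar_coeff_bound[OF schwartz_shift_lipschitz[OF s, of _ _ m] schwartz_shift_bound(1)[OF s] schwartz_shift_continuous[OF s], of j i]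
    by (simp add: q wavelet_coeff_def wavelet_weight_def mult_ac)
qed

lemma wavelet_coeff_add:
  assumes "s \<in> schwartz" "t \<in> schwartz"
  shows "wavelet_coeff (\<lambda>x. s x + t x) q = wavelet_coeff s q + wavelet_coeff t q"
  using assms by (auto simp: wavelet_coeff_def haar_coeff_add schwartz_shift_continuous split: prod.split)

lemma wavelet_coeff_cmult: "wavelet_coeff (\<lambda>x. c * s x) q = c * wavelet_coeff s q"
  by (auto simp: wavelet_coeff_def haar_coeff_cmult split: prod.split)

text \<open>Half-open intervals partition the line exactly, while the Haar analysis uses closed
  ones; the two differ by a null set.\<close>

lemma schwartz_square_unit_integral:
  assumes s: "s \<in> schwartz"
  shows "integrable lborel (\<lambda>x. indicator {of_int l..<of_int l + 1} x * (s x)\<^sup>2)"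
    and "integral {0..1} (\<lambda>x. (s (of_int l + x))\<^sup>2) = (LINT x|lborel. indicator {of_int l..<of_int l + 1} x * (s x)\<^sup>2)"
proof -
  have "set_integrable lborel {of_int l..of_int l + 1} (\<lambda>x. (s x)\<^sup>2)"
    by (rule borel_integrable_atLeastAtMost') (intro continuous_intros schwartz_continuous_on[OF s])
  then have int: "integrable lborel (\<lambda>x. indicator {of_int l..of_int l + 1} x * (s x)\<^sup>2)"
    by (simp add: set_integrable_def)
  have [measurable]: "s \<in> borel_measurable borel"
    by (rule borel_measurable_continuous_onI) (rule schwartz_continuous_on[OF s])
  have AE: "AE x in lborel. indicator {of_int l..of_int l + 1} x * (s x)\<^sup>2 = indicator {of_int l..<of_int l + 1} x * (s x)\<^sup>2"
    using AE_lborel_singleton[of "of_int l + 1"] by eventually_elim (auto split: split_indicator)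
  show "integrable lborel (\<lambda>x. indicator {of_int l..<of_int l + 1} x * (s x)\<^sup>2)"
    using int by (subst integrable_cong_AE[OF _ _ AE, symmetric]) auto
  have u: "set_integrable lborel {0..1} (\<lambda>x. (s (of_int l + x))\<^sup>2)"
    by (rule borel_integrable_atLeastAtMost')
       (intro continuous_intros continuous_on_compose2[OF schwartz_continuous_on[OF s, of UNIV]]; simp)
  have "integral {0..1} (\<lambda>x. (s (of_int l + x))\<^sup>2) = (LINT x|lborel. indicator {0..1} x * (s (of_int l + x))\<^sup>2)"
    using set_borel_integral_eq_integral(2)[OF u] by (simp add: set_lebesgue_integral_def)
  also have "\<dots> = (LINT x|lborel. indicator {of_int l..of_int l + 1} (of_int l + 1 * x) * (s (of_int l + 1 * x))\<^sup>2)"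
    by (intro Bochner_Integration.integral_cong) (auto split: split_indicator)
  also have "\<dots> = (LINT x|lborel. indicator {of_int l..of_int l + 1} x * (s x)\<^sup>2)"
    using lborel_integral_real_affine[of 1 "\<lambda>x. indicator {of_int l..of_int l + 1} x * (s x)\<^sup>2" "of_int l"] by simp
  also have "\<dots> = (LINT x|lborel. indicator {of_int l..<of_int l + 1} x * (s x)\<^sup>2)"
    by (rule integral_cong_AE[OF _ _ AE]) auto
  finally show "integral {0..1} (\<lambda>x. (s (of_int l + x))\<^sup>2) = (LINT x|lborel. indicator {of_int l..<of_int l + 1} x * (s x)\<^sup>2)" .
qed

lemma schwartz_square_sums:
  assumes s: "s \<in> schwartz"
  shows "(\<lambda>m. integral {0..1} (\<lambda>x. (s (of_int (int_decode m) + x))\<^sup>2)) sums (L2_norm_real s)\<^sup>2"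
proof -
  define f where "f m x = indicator {of_int (int_decode m)..<of_int (int_decode m) + 1} x * (s x)\<^sup>2" for m x
  have int: "integrable lborel (f m)" for m
    unfolding f_def by (rule schwartz_square_unit_integral(1)[OF s])
  have eq: "integral {0..1} (\<lambda>x. (s (of_int (int_decode m) + x))\<^sup>2) = integral\<^sup>L lborel (f m)" for m
    unfolding f_def by (rule schwartz_square_unit_integral(2)[OF s])
  have abs: "\<bar>f m x\<bar> = f m x" for m x by (simp add: f_def)
  have pointwise: "(\<lambda>m. f m x) sums (s x)\<^sup>2" for x
  proof -
    \<comment> \<open>Exactly one interval contains \<open>x\<close>, the one starting at its floor,
      so the series has a single nonzero term at most.\<close>
    have "f m x = (if m = int_encode \<lfloor>x\<rfloor> then (s x)\<^sup>2 else 0)" for m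
    proof -
      have "x \<in> {of_int (int_decode m)..<of_int (int_decode m) + 1} \<longleftrightarrow> int_decode m = \<lfloor>x\<rfloor>"
        by (auto simp: floor_unique)
      also have "\<dots> \<longleftrightarrow> m = int_encode \<lfloor>x\<rfloor>" by (metis int_decode_inverse int_encode_inverse)
      finally show ?thesis by (simp add: f_def indicator_def)
    qed
    then show ?thesis using sums_single[of "int_encode \<lfloor>x\<rfloor>" "\<lambda>_. (s x)\<^sup>2"] by simp
  qed
  define K where "K = schwartz_bound s"
  \<comment> \<open>Summability of these integrals permits exchanging sum and integral. Squaring the
    shift bound gives the constant 9 and two factors \<open>unit_weight m\<close>, one of which is
    at most 1.\<close>
  have "\<bar>integral {0..1} (\<lambda>x. (s (of_int (int_decode m) + x))\<^sup>2)\<bar> \<le> 9 * K\<^sup>2 * unit_weight m" for m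
  proof -
    have sq: "continuous_on {0..1} (\<lambda>x. (s (of_int (int_decode m) + x))\<^sup>2)"
      by (intro continuous_intros schwartz_shift_continuous s)
    have "unit_weight m * unit_weight m \<le> unit_weight m * 1"
      using unit_weight_pos[of m] by (intro mult_left_mono) (auto simp: unit_weight_def)
    then have le: "(3 * unit_weight m * K)\<^sup>2 \<le> 9 * K\<^sup>2 * unit_weight m"
      using mult_left_mono[of "unit_weight m * unit_weight m" "unit_weight m" "9 * K\<^sup>2"]
      by (simp add: power2_eq_square mult_ac)
    have "norm (integral (cbox 0 1) (\<lambda>x. (s (of_int (int_decode m) + x))\<^sup>2)) \<le> 9 * K\<^sup>2 * unit_weight m * measure lborel (cbox 0 (1::real))"
    proof (rule integrable_bound)
      fix x :: real assume "x \<in> cbox 0 1"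
      then have "\<bar>s (of_int (int_decode m) + x)\<bar>\<^sup>2 \<le> (3 * unit_weight m * K)\<^sup>2"
        unfolding K_def by (intro power_mono schwartz_shift_bound s) auto
      then show "norm ((s (of_int (int_decode m) + x))\<^sup>2) \<le> 9 * K\<^sup>2 * unit_weight m"
        using le by simp
    qed (use sq unit_weight_pos[of m] in \<open>auto intro: integrable_continuous_real\<close>)
    then show ?thesis by simp
  qed
  then have "summable (\<lambda>m. integral\<^sup>L lborel (f m))"
    unfolding eq by (intro summable_comparison_test[OF _ summable_mult[OF summable_unit_weight, of "9 * K\<^sup>2"]]) auto
  then have "(\<lambda>m. integral\<^sup>L lborel (f m)) sums (\<integral>x. (\<Sum>m. f m x) \<partial>lborel)"
    using pointwise by (intro sums_integral int) (auto simp: abs sums_iff)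
  then show ?thesis
    unfolding eq using pointwise by (simp add: L2_norm_real_def sums_iff)
qed

lemma wavelet_parseval:
  assumes s: "s \<in> schwartz"
  shows "((\<lambda>q. (wavelet_coeff s q)\<^sup>2) has_sum (L2_norm_real s)\<^sup>2) UNIV"
proof (rule nonneg_has_sum_prod)
  show "((\<lambda>m. integral {0..1} (\<lambda>x. (s (of_int (int_decode m) + x))\<^sup>2)) has_sum (L2_norm_real s)\<^sup>2) UNIV"
    by (rule sums_nonneg_imp_has_sum[OF schwartz_square_sums[OF s]])
       (auto intro!: integral_nonneg integrable_continuous_real continuous_on_power schwartz_shift_continuous[OF s])
  fix m
  define u where "u x = s (of_int (int_decode m) + x)" for x
  show "((\<lambda>p. (wavelet_coeff s (m, p))\<^sup>2) has_sum integral {0..1} (\<lambda>x. (s (of_int (int_decode m) + x))\<^sup>2)) UNIV"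
  proof (rule nonneg_has_sum_prod)
    show "((\<lambda>i. (wavelet_coeff s (m, j, i))\<^sup>2) has_sum (\<Sum>i<2 ^ (j - 1). (haar_coeff j i u)\<^sup>2)) UNIV" for j
      using has_sum_initial_segment[of "2 ^ (j - 1)" "\<lambda>i. (haar_coeff j i u)\<^sup>2"]
      by (simp add: wavelet_coeff_def u_def[abs_def] haar_coeff_def)
    have "(\<lambda>j. \<Sum>i<2 ^ (j - 1). (haar_coeff j i u)\<^sup>2) sums integral {0..1} (\<lambda>x. (u x)\<^sup>2)"
      unfolding u_def using unit_weight_pos[of m] schwartz_bound_nonneg[OF s]
      by (intro haar_parseval[OF schwartz_shift_lipschitz[OF s]] schwartz_shift_continuous s) auto
    then show "((\<lambda>j. \<Sum>i<2 ^ (j - 1). (haar_coeff j i u)\<^sup>2) has_sum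
        integral {0..1} (\<lambda>x. (s (of_int (int_decode m) + x))\<^sup>2)) UNIV"
      by (intro sums_nonneg_imp_has_sum) (auto simp: u_def intro: sum_nonneg)
  qed auto
qed auto

text \<open>The interface to the probabilistic part. Flattening the triple index to
  \<open>nat\<close> turns unordered sums into series of partial sums, and choosing
  \<open>\<beta>\<close> before \<open>s\<close> is what allows one null set for all test
  functions.\<close>

lemma wavelet_coordinates:
  obtains C :: "(real \<Rightarrow> real) \<Rightarrow> nat \<Rightarrow> real" and \<beta> where
    "summable \<beta>" and "\<And>q. \<beta> q \<ge> 0"
    and "\<And>s q. s \<in> schwartz \<Longrightarrow> \<bar>C s q\<bar> \<le> schwartz_bound s * \<beta> q"
    and "\<And>s t q. s \<in> schwartz \<Longrightarrow> t \<in> schwartz \<Longrightarrow> C (\<lambda>x. s x + t x) q = C s q + C t q"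
    and "\<And>c s q. C (\<lambda>x. c * s x) q = c * C s q"
    and "\<And>s. s \<in> schwartz \<Longrightarrow> (\<lambda>q. (C s q)\<^sup>2) sums (L2_norm_real s)\<^sup>2"
proof -
  define d :: "nat \<Rightarrow> nat \<times> nat \<times> nat" where "d = from_nat_into UNIV"
  have bij: "bij_betw d UNIV UNIV"
    unfolding d_def by (rule bij_betw_from_nat_into) (auto simp: finite_prod)
  have "(\<lambda>q. wavelet_weight (d q)) summable_on UNIV"
    using summable_on_wavelet_weight by (subst summable_on_reindex_bij_betw[OF bij])
  then have "summable (\<lambda>q. wavelet_weight (d q))" by (rule summable_on_imp_summable)
  moreover have "(\<lambda>q. (wavelet_coeff s (d q))\<^sup>2) sums (L2_norm_real s)\<^sup>2" if "s \<in> schwartz" for s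
    using wavelet_parseval[OF that]
    by (intro has_sum_imp_sums) (subst has_sum_reindex_bij_betw[OF bij, of "\<lambda>q. (wavelet_coeff s q)\<^sup>2"])
  moreover have "wavelet_weight q \<ge> 0" for q
    by (simp add: wavelet_weight_def haar_weight_nonneg unit_weight_pos[THEN less_imp_le] split: prod.split)
  ultimately show ?thesis
    by (intro that[of "\<lambda>q. wavelet_weight (d q)" "\<lambda>s q. wavelet_coeff s (d q)"])
       (auto simp: wavelet_coeff_bound wavelet_coeff_add wavelet_coeff_cmult)
qed

subsection \<open>White noise and its scale mixtures\<close>

abbreviation noise :: "(nat \<Rightarrow> real) measure" where
  "noise \<equiv> Pi\<^sub>M UNIV (\<lambda>_. std_normal_distribution)"

lemma prob_space_std_normal: "prob_space std_normal_distribution"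
  by (rule prob_space_normal_density) simp

lemma prob_space_noise: "prob_space noise"
  by (rule prob_space_PiM) (rule prob_space_std_normal)

lemma measurable_noise_component [measurable]: "(\<lambda>\<omega>. \<omega> q) \<in> borel_measurable noise"
  using measurable_component_singleton[of q UNIV "\<lambda>_. std_normal_distribution"] by simp

lemma distr_noise_component: "distr noise std_normal_distribution (\<lambda>\<omega>. \<omega> q) = std_normal_distribution"
  by (rule distr_PiM_component) (auto intro: prob_space_std_normal)

lemma indep_vars_noise:
  "prob_space.indep_vars noise (\<lambda>_. std_normal_distribution) (\<lambda>q \<omega>. \<omega> q) (UNIV :: nat set)"
proof -
  interpret prob_space noise by (rule prob_space_noise)
  have "distr noise noise (\<lambda>\<omega>. \<lambda>q\<in>UNIV. \<omega> q) = noise"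
    by (simp add: distr_id restrict_UNIV)
  then show ?thesis
    by (subst indep_vars_iff_distr_eq_PiM') (auto simp: distr_noise_component)
qed

lemma AE_noise_summable:
  assumes \<beta>: "summable \<beta>" "\<And>q. \<beta> q \<ge> 0"
  shows "AE \<omega> in noise. summable (\<lambda>q. \<bar>\<omega> q\<bar> * \<beta> q)"
proof -
  define a where "a = (\<integral>\<^sup>+ x. ennreal \<bar>x\<bar> \<partial>std_normal_distribution)"
  have "integrable std_normal_distribution (\<lambda>x. \<bar>x\<bar>)"
    using integrable_std_normal_moment_abs[of 1] by (subst integrable_density) auto
  then have a: "a < \<infinity>" unfolding a_def by (simp add: integrable_iff_bounded)
  have "(\<integral>\<^sup>+ \<omega>. ennreal \<bar>\<omega> q\<bar> \<partial>noise) = a" for q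
  proof -
    have "a = (\<integral>\<^sup>+ x. ennreal \<bar>x\<bar> \<partial>distr noise std_normal_distribution (\<lambda>\<omega>. \<omega> q))"
      by (simp add: a_def distr_noise_component)
    then show ?thesis by (subst (asm) nn_integral_distr) auto
  qed
  then have "(\<integral>\<^sup>+ \<omega>. (\<Sum>q. ennreal (\<bar>\<omega> q\<bar> * \<beta> q)) \<partial>noise) = (\<Sum>q. a * ennreal (\<beta> q))"
    by (subst nn_integral_suminf) (simp_all add: ennreal_mult \<beta> nn_integral_multc)
  also have "\<dots> = a * ennreal (\<Sum>q. \<beta> q)" using \<beta> by (simp add: suminf_ennreal2)
  also have "\<dots> \<noteq> \<infinity>" using a by (simp add: ennreal_mult_eq_top_iff less_top)
  finally have "AE \<omega> in noise. (\<Sum>q. ennreal (\<bar>\<omega> q\<bar> * \<beta> q)) \<noteq> \<infinity>"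
    by (intro nn_integral_PInf_AE) auto
  then show ?thesis
    by eventually_elim (auto intro!: summable_suminf_not_top simp: \<beta>)
qed

lemma char_noise_finite_sum:
  "(CLINT \<omega>|noise. iexp (\<Sum>q<n. \<omega> q * c q)) = of_real (exp (- (\<Sum>q<n. (c q)\<^sup>2) / 2))"
proof -
  interpret prob_space noise by (rule prob_space_noise)
  have indep: "indep_vars (\<lambda>_. borel) (\<lambda>q \<omega>. \<omega> q * c q) {..<n}"
    using indep_vars_compose2[OF indep_vars_subset[OF indep_vars_noise, of "{..<n}"], of "\<lambda>q x. x * c q" "\<lambda>_. borel"]
    by simp
  have comp: "char (distr noise borel (\<lambda>\<omega>. \<omega> q * c q)) 1 = of_real (exp (- (c q)\<^sup>2 / 2))" for q
  proof -
    have "char (distr noise borel (\<lambda>\<omega>. \<omega> q * c q)) 1 = (CLINT \<omega>|noise. iexp (c q * \<omega> q))"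
      unfolding char_def by (subst integral_distr) (auto simp: mult.commute)
    also have "\<dots> = (CLINT x|distr noise std_normal_distribution (\<lambda>\<omega>. \<omega> q). iexp (c q * x))"
      by (subst integral_distr) auto
    also have "\<dots> = char std_normal_distribution (c q)"
      by (simp add: distr_noise_component char_def)
    finally show ?thesis by (simp add: char_std_normal_distribution)
  qed
  have "(CLINT \<omega>|noise. iexp (\<Sum>q<n. \<omega> q * c q)) = char (distr noise borel (\<lambda>\<omega>. \<Sum>q<n. \<omega> q * c q)) 1"
    unfolding char_def by (subst integral_distr) auto
  also have "\<dots> = (\<Prod>q<n. of_real (exp (- (c q)\<^sup>2 / 2)))"
    by (simp only: char_distr_sum[OF indep] comp)
  also have "\<dots> = of_real (exp (\<Sum>q<n. - (c q)\<^sup>2 / 2))" by (simp add: exp_sum)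
  also have "(\<Sum>q<n. - (c q)\<^sup>2 / 2) = - (\<Sum>q<n. (c q)\<^sup>2) / 2"
    by (simp add: sum_negf sum_divide_distrib)
  finally show ?thesis .
qed

text \<open>Characters have modulus 1, so dominated convergence passes from the finite Gaussian sums
  to the almost sure limit.\<close>

lemma char_noise_series:
  assumes c: "(\<lambda>q. (c q)\<^sup>2) sums v" and Z[measurable]: "Z \<in> borel_measurable noise"
    and lim: "AE \<omega> in noise. (\<lambda>q. \<omega> q * c q) sums Z \<omega>"
  shows "(CLINT \<omega>|noise. iexp (Z \<omega>)) = of_real (exp (- v / 2))"
proof (rule LIMSEQ_unique)
  interpret prob_space noise by (rule prob_space_noise)
  show "(\<lambda>n. CLINT \<omega>|noise. iexp (\<Sum>q<n. \<omega> q * c q)) \<longlonglongrightarrow> (CLINT \<omega>|noise. iexp (Z \<omega>))"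
  proof (rule integral_dominated_convergence[where w = "\<lambda>_. 1"])
    show "AE \<omega> in noise. (\<lambda>n. iexp (\<Sum>q<n. \<omega> q * c q)) \<longlonglongrightarrow> iexp (Z \<omega>)"
      using lim unfolding sums_def
      by eventually_elim (intro tendsto_exp tendsto_mult tendsto_const tendsto_of_real)
  qed auto
  show "(\<lambda>n. CLINT \<omega>|noise. iexp (\<Sum>q<n. \<omega> q * c q)) \<longlonglongrightarrow> of_real (exp (- v / 2))"
    unfolding char_noise_finite_sum using c by (intro tendsto_intros) (auto simp: sums_def)
qed

lemma measurable_tempered_spaceI:
  assumes T: "\<And>p. p \<in> space M \<Longrightarrow> T p \<in> tempered"
    and meas: "\<And>s. s \<in> schwartz \<Longrightarrow> (\<lambda>p. T p s) \<in> borel_measurable M"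
  shows "T \<in> measurable M tempered_space"
proof (rule measurable_sigma_sets[OF sets_tempered_space_boxes cylinder_boxes_subset])
  show "T \<in> space M \<rightarrow> tempered" using T by auto
  fix X assume "X \<in> cylinder_boxes"
  then obtain J A where J: "finite J" "J \<subseteq> schwartz" and A: "\<And>j. A j \<in> sets borel"
    and X_eq: "X = {w \<in> tempered. \<forall>j\<in>J. w j \<in> A j}" by (auto simp: cylinder_boxes_def)
  have "{p \<in> space M. \<forall>j\<in>J. T p j \<in> A j} \<in> sets M"
    using J measurable_sets[OF meas A]
    by (intro sets.sets_Collect_finite_All) (auto simp: vimage_def Int_def conj_commute)
  also have "{p \<in> space M. \<forall>j\<in>J. T p j \<in> A j} = T -` X \<inter> space M" using T by (auto simp: X_eq)
  finally show "T -` X \<inter> space M \<in> sets M" .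
qed

lemma exists_gaussian_mixture:
  assumes \<mu>: "prob_space \<mu>" "sets \<mu> = sets borel"
  shows "\<exists>P. prob_space P \<and> sets P = sets tempered_space \<and>
    (\<forall>s\<in>schwartz. (CLINT w|P. iexp (w s)) = of_real (LINT r|\<mu>. exp (- (r\<^sup>2 * ((L2_norm_real s)\<^sup>2 / 2)))))"
proof -
  obtain C :: "(real \<Rightarrow> real) \<Rightarrow> nat \<Rightarrow> real" and \<beta> where
    \<beta>: "summable \<beta>" "\<And>q. \<beta> q \<ge> 0" and
    C_bound: "\<And>s q. s \<in> schwartz \<Longrightarrow> \<bar>C s q\<bar> \<le> schwartz_bound s * \<beta> q" and
    C_add: "\<And>s t q. s \<in> schwartz \<Longrightarrow> t \<in> schwartz \<Longrightarrow> C (\<lambda>x. s x + t x) q = C s q + C t q" and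
    C_cmult: "\<And>c s q. C (\<lambda>x. c * s x) q = c * C s q" and
    C_sums: "\<And>s. s \<in> schwartz \<Longrightarrow> (\<lambda>q. (C s q)\<^sup>2) sums (L2_norm_real s)\<^sup>2"
    by (rule wavelet_coordinates) (rule that)
  interpret \<mu>: prob_space \<mu> by fact
  interpret noise: prob_space noise by (rule prob_space_noise)
  interpret pair: pair_prob_space noise \<mu> ..
  have [measurable_cong]: "sets \<mu> = sets borel" by fact
  \<comment> \<open>The event does not mention a test function. A sum in \<open>ennreal\<close>
    makes its measurability immediate.\<close>
  define good where "good \<omega> \<longleftrightarrow> (\<Sum>q. ennreal (\<bar>\<omega> q\<bar> * \<beta> q)) < \<infinity>" for \<omega> :: "nat \<Rightarrow> real"
  have [measurable]: "Measurable.pred noise good" unfolding good_def by measurable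
  have good: "good \<omega> \<longleftrightarrow> summable (\<lambda>q. \<bar>\<omega> q\<bar> * \<beta> q)" for \<omega>
  proof
    show "good \<omega> \<Longrightarrow> summable (\<lambda>q. \<bar>\<omega> q\<bar> * \<beta> q)"
      using \<beta> by (intro summable_suminf_not_top) (auto simp: good_def)
    show "summable (\<lambda>q. \<bar>\<omega> q\<bar> * \<beta> q) \<Longrightarrow> good \<omega>"
      using \<beta> by (simp add: good_def ennreal_suminf_neq_top less_top[symmetric])
  qed
  \<comment> \<open>Off the good event the zero functional is used: it is tempered too, so the map
    \<open>T\<close> below takes values in \<open>tempered\<close> for every outcome, not just
    almost every one.\<close>
  define W where "W \<omega> s = (if good \<omega> then \<Sum>q. \<omega> q * C s q else 0)" for \<omega> s
  have W_meas[measurable]: "(\<lambda>\<omega>. W \<omega> s) \<in> borel_measurable noise" for s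
    unfolding W_def by measurable
  have term_bound: "\<bar>\<omega> q * C s q\<bar> \<le> schwartz_bound s * (\<bar>\<omega> q\<bar> * \<beta> q)" if "s \<in> schwartz" for \<omega> q s
    using mult_left_mono[OF C_bound[OF that, of q], of "\<bar>\<omega> q\<bar>"] by (simp add: abs_mult mult_ac)
  have abs_summable: "summable (\<lambda>q. \<bar>\<omega> q * C s q\<bar>)" if "good \<omega>" "s \<in> schwartz" for \<omega> s
  proof (rule summable_comparison_test'[where N = 0])
    show "summable (\<lambda>q. schwartz_bound s * (\<bar>\<omega> q\<bar> * \<beta> q))"
      using that(1) unfolding good by (rule summable_mult)
    show "norm \<bar>\<omega> q * C s q\<bar> \<le> schwartz_bound s * (\<bar>\<omega> q\<bar> * \<beta> q)" for q
      unfolding real_norm_def abs_idempotent using that(2) by (rule term_bound)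
  qed
  have W_sums: "(\<lambda>q. \<omega> q * C s q) sums W \<omega> s" if "good \<omega>" "s \<in> schwartz" for \<omega> s
    using summable_rabs_cancel[OF abs_summable[OF that]] that by (simp add: W_def summable_sums)
  have W_bound: "\<bar>W \<omega> s\<bar> \<le> (\<Sum>q. \<bar>\<omega> q\<bar> * \<beta> q) * schwartz_bound s" if "good \<omega>" "s \<in> schwartz" for \<omega> s
  proof -
    have "\<bar>W \<omega> s\<bar> \<le> (\<Sum>q. \<bar>\<omega> q * C s q\<bar>)"
      using summable_rabs[OF abs_summable[OF that]] that by (simp add: W_def)
    also have "\<dots> \<le> (\<Sum>q. schwartz_bound s * (\<bar>\<omega> q\<bar> * \<beta> q))"
      using that by (intro suminf_le term_bound abs_summable summable_mult) (auto simp: good)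
    also have "\<dots> = (\<Sum>q. \<bar>\<omega> q\<bar> * \<beta> q) * schwartz_bound s"
      using that by (subst suminf_mult) (auto simp: good)
    finally show ?thesis .
  qed
  have W_add: "W \<omega> (\<lambda>x. s x + t x) = W \<omega> s + W \<omega> t" if "s \<in> schwartz" "t \<in> schwartz" for \<omega> s t
  proof (cases "good \<omega>")
    case True
    have "(\<lambda>q. \<omega> q * C (\<lambda>x. s x + t x) q) sums (W \<omega> s + W \<omega> t)"
      using sums_add[OF W_sums[OF True that(1)] W_sums[OF True that(2)]] that by (simp add: C_add algebra_simps)
    then show ?thesis using W_sums[OF True schwartz_add[OF that]] sums_unique2 by blast
  qed (simp add: W_def)
  have W_cmult: "W \<omega> (\<lambda>x. c * s x) = c * W \<omega> s" if "s \<in> schwartz" for \<omega> s c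
  proof (cases "good \<omega>")
    case True
    have "(\<lambda>q. \<omega> q * C (\<lambda>x. c * s x) q) sums (c * W \<omega> s)"
      using sums_mult[OF W_sums[OF True that], of c] by (simp add: C_cmult algebra_simps)
    then show ?thesis using W_sums[OF True schwartz_cmult[OF that]] sums_unique2 by blast
  qed (simp add: W_def)
  define T where "T = (\<lambda>(\<omega>, r). restrict (\<lambda>s. r * W \<omega> s) schwartz)"
  have T_apply: "T (\<omega>, r) s = r * W \<omega> s" if "s \<in> schwartz" for \<omega> r s using that by (simp add: T_def)
  have T_tempered: "T (\<omega>, r) \<in> tempered" for \<omega> r
  proof (rule temperedI)
    show "T (\<omega>, r) \<in> extensional schwartz" by (simp add: T_def)
    fix f assume f: "f \<in> schwartz"
    \<comment> \<open>The constant depends on the outcome but not on \<open>f\<close>, which is all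
      that continuity of this one functional asks for.\<close>
    show "\<bar>T (\<omega>, r) f\<bar> \<le> (if good \<omega> then \<bar>r\<bar> * (\<Sum>q. \<bar>\<omega> q\<bar> * \<beta> q) else 0) * schwartz_bound f"
      using mult_left_mono[OF W_bound[OF _ f, of \<omega>], of "\<bar>r\<bar>"]
      by (cases "good \<omega>") (auto simp: T_apply[OF f] abs_mult mult.assoc W_def)
  qed (simp_all add: T_apply schwartz_add schwartz_cmult W_add W_cmult algebra_simps)
  have T_meas: "T \<in> measurable (noise \<Otimes>\<^sub>M \<mu>) tempered_space"
  proof (rule measurable_tempered_spaceI)
    show "T p \<in> tempered" for p using T_tempered by (cases p) auto
    fix s assume s: "s \<in> schwartz"
    have "(\<lambda>p. snd p * W (fst p) s) \<in> borel_measurable (noise \<Otimes>\<^sub>M \<mu>)" by measurable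
    also have "(\<lambda>p. snd p * W (fst p) s) = (\<lambda>p. T p s)" using T_apply[OF s] by (auto simp: fun_eq_iff)
    finally show "(\<lambda>p. T p s) \<in> borel_measurable (noise \<Otimes>\<^sub>M \<mu>)" .
  qed
  define P where "P = distr (noise \<Otimes>\<^sub>M \<mu>) tempered_space T"
  have "prob_space P" unfolding P_def by (rule pair.prob_space_distr[OF T_meas])
  moreover have "sets P = sets tempered_space" by (simp add: P_def)
  moreover have "(CLINT w|P. iexp (w s)) = of_real (LINT r|\<mu>. exp (- (r\<^sup>2 * ((L2_norm_real s)\<^sup>2 / 2))))"
    if s: "s \<in> schwartz" for s
  proof -
    have iexp_meas: "(\<lambda>w. iexp (w s)) \<in> borel_measurable tempered_space"
      by (rule measurable_compose[OF measurable_evaluation[OF s]]) measurable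
    have scaled: "(CLINT \<omega>|noise. iexp (r * W \<omega> s)) = of_real (exp (- (r\<^sup>2 * ((L2_norm_real s)\<^sup>2 / 2))))" for r
    proof -
      have "(\<lambda>q. (r * C s q)\<^sup>2) sums (r\<^sup>2 * (L2_norm_real s)\<^sup>2)"
        using sums_mult[OF C_sums[OF s], of "r\<^sup>2"] by (simp add: power_mult_distrib)
      moreover have "AE \<omega> in noise. (\<lambda>q. \<omega> q * (r * C s q)) sums (r * W \<omega> s)"
        using AE_noise_summable[OF \<beta>]
      proof eventually_elim
        case (elim \<omega>)
        then have "good \<omega>" by (simp add: good)
        then show ?case using sums_mult[OF W_sums[OF _ s], of \<omega> r] by (simp add: mult_ac)
      qed
      ultimately show ?thesis
        using char_noise_series[of "\<lambda>q. r * C s q" "r\<^sup>2 * (L2_norm_real s)\<^sup>2" "\<lambda>\<omega>. r * W \<omega> s"] by simp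
    qed
    have "(CLINT w|P. iexp (w s)) = (CLINT p|(noise \<Otimes>\<^sub>M \<mu>). iexp (T p s))"
      unfolding P_def by (rule integral_distr[OF T_meas iexp_meas])
    also have "\<dots> = (CLINT p|(noise \<Otimes>\<^sub>M \<mu>). iexp (snd p * W (fst p) s))"
      using T_apply[OF s] by (intro Bochner_Integration.integral_cong) auto
    \<comment> \<open>The noise is integrated first: for fixed \<open>r\<close> the functional is
      Gaussian with coordinates \<open>r * C s q\<close>, and \<open>scaled\<close> applies.\<close>
    also have "\<dots> = (CLINT r|\<mu>. CLINT \<omega>|noise. iexp (r * W \<omega> s))"
    proof -
      have "integrable (noise \<Otimes>\<^sub>M \<mu>) (\<lambda>(\<omega>, r). iexp (r * W \<omega> s))"
        by (rule bounded_complex_integrable[OF pair.prob_space_axioms, where B = 1]) auto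
      from pair.integral_snd[OF this] show ?thesis by (simp add: case_prod_unfold)
    qed
    also have "\<dots> = of_real (LINT r|\<mu>. exp (- (r\<^sup>2 * ((L2_norm_real s)\<^sup>2 / 2))))"
      unfolding scaled by (rule integral_complex_of_real)
    finally show ?thesis .
  qed
  ultimately show ?thesis by blast
qed

theorem theorem4p12:
  fixes n :: nat
  assumes "n \<ge> 1"
  shows "\<exists>!P. prob_space P \<and> sets P = sets tempered_space \<and>
           (\<forall>s\<in>schwartz.
              phi_tilde n (complex_of_real (- ((L2_norm_real s)\<^sup>2 / 2))) =
              (LINT w|P. exp (\<i> * complex_of_real (w s))))"
proof -
  obtain \<mu> where \<mu>: "prob_space \<mu>" "sets \<mu> = sets borel"
    and mix: "\<And>x. x \<ge> 0 \<Longrightarrow> phi_tilde n (of_real (- x)) = of_real (LINT r|\<mu>. exp (- (r\<^sup>2 * x)))"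
    using phi_tilde_mixture[OF assms] by blast
  from exists_gaussian_mixture[OF \<mu>] obtain P where P: "prob_space P" "sets P = sets tempered_space"
    and char: "\<And>s. s \<in> schwartz \<Longrightarrow> (CLINT w|P. iexp (w s)) =
      of_real (LINT r|\<mu>. exp (- (r\<^sup>2 * ((L2_norm_real s)\<^sup>2 / 2))))" by blast
  have eq: "phi_tilde n (complex_of_real (- ((L2_norm_real s)\<^sup>2 / 2))) = (CLINT w|P. iexp (w s))"
    if "s \<in> schwartz" for s
    unfolding char[OF that] by (rule mix) simp
  show ?thesis
  proof (rule ex1I[of _ P])
    show "prob_space P \<and> sets P = sets tempered_space \<and>
        (\<forall>s\<in>schwartz. phi_tilde n (complex_of_real (- ((L2_norm_real s)\<^sup>2 / 2))) =
          (LINT w|P. exp (\<i> * complex_of_real (w s))))"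
      using P eq by blast
  next
    fix Q assume Q: "prob_space Q \<and> sets Q = sets tempered_space \<and>
        (\<forall>s\<in>schwartz. phi_tilde n (complex_of_real (- ((L2_norm_real s)\<^sup>2 / 2))) =
          (LINT w|Q. exp (\<i> * complex_of_real (w s))))"
    show "Q = P"
    proof (rule tempered_char_unique)
      fix s assume "s \<in> schwartz"
      then show "(CLINT w|Q. iexp (w s)) = (CLINT w|P. iexp (w s))"
        using Q eq by metis
    qed (use P Q in auto)
  qed
qed

end
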